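(* Let $K$ be an algebraically closed field of characteristic $\operatorname{char} K\neq 2,3$, let $\lambda\in K$ with $\lambda^{3}+27\neq 0$, and let $E\subset\mathbb P^{2}$ be the smooth plane projective curve with equation $$x_{0}^{3}+x_{1}^{3}+x_{2}^{3}+\lambda x_{0}x_{1}x_{2}=0 .$$ Each linear determinantal representation of $E$ is equivalent to a Moore matrix $$M_{(a_{0},a_{1},a_{2}),x}=\begin{pmatrix} a_{0}x_{0}&a_{1}x_{2}&a_{2}x_{1}\\ a_{1}x_{1}&a_{2}x_{0}&a_{0}x_{2}\\ a_{2}x_{2}&a_{0}x_{1}&a_{1}x_{0}\end{pmatrix}$$ with $\mathbf a=[a_{0}:a_{1}:a_{2}]\in E$ and $a_{0}a_{1}a_{2}\neq 0$. Two such Moore matrices $M_{(a_{0},a_{1},a_{2}),x}$ and $M_{(a_{0}',a_{1}',a_{2}'),x}$ (with $\mathbf a,\mathbf a'\in E$, $a_0a_1a_2\ne0$, $a_0'a_1'a_2'\neq 0$) yield equivalent linear determinantal representations of $E$ if, and only if, $3\cdot_{E}\mathbf a=3\cdot_{E}\mathbf a'$, where $3\cdot_{E}\mathbf a=\mathbf a+_{E}\mathbf a+_{E}\mathbf a$ is calculated with respect to the group law $+_{E}$ on $E$ whose identity element is the inflection point $\mathfrak o=[0:-1:1]$.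
   Context: Let $S=K[x_{0},x_{1},x_{2}]$ and $f=x_{0}^{3}+x_{1}^{3}+x_{2}^{3}+\lambda x_{0}x_{1}x_{2}$. A linear determinantal representation of $E=V(f)$ is a matrix $M\in\mathrm{Mat}_{3\times 3}(S)$ whose entries are linear homogeneous polynomials and such that $\det M=c f$ for some nonzero scalar $c\in K$. Two such matrices $M,M'$ are equivalent if $M'=PMQ^{-1}$ for some $P,Q\in \mathrm{GL}(3,K)$. With rows and columns indexed by $i,j\in\mathbb Z/3\mathbb Z$, the Moore matrix is $M_{(a_0,a_1,a_2),x}=(a_{i+j}x_{i-j})_{i,j\in\mathbb Z/3\mathbb Z}$. *)

theory Defs
  imports
    "HOL-Analysis.Analysis"
    "HOL-Library.Poly_Mapping"
    "HOL-Library.Multiset"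
    "HOL-Computational_Algebra.Polynomial"
begin

text \<open>
  Vectors and matrices are indexed by the three-element type \<^typ>\<open>3\<close>, whose arithmetic is
  that of the integers modulo 3, with elements \<open>0\<close>, \<open>1\<close> and \<open>2\<close> (and \<open>3 = 0\<close>).
  Beware that the library's \<open>vector [a, b, c]\<close> starts at index \<open>1\<close>, so that
  \<open>vector [a, b, c] $ 0 = c\<close>; hence the following constructor.
\<close>

definition vec3 :: "'a \<Rightarrow> 'a \<Rightarrow> 'a \<Rightarrow> 'a^3" where
  "vec3 a b c = (\<chi> i. if i = 0 then a else if i = 1 then b else c)"

text \<open>
  The Hesse cubic over an arbitrary commutative ring. It is used for polynomials in
  \<open>x\<^sub>0, x\<^sub>1, x\<^sub>2\<close>, for points over the field, and for lines parametrised over \<open>K[t]\<close>.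
\<close>

definition hesse :: "'r::comm_ring_1 \<Rightarrow> 'r^3 \<Rightarrow> 'r" where
  "hesse lam x = (x$0)^3 + (x$1)^3 + (x$2)^3 + lam * x$0 * x$1 * x$2"


section \<open>Linear determinantal representations\<close>

text \<open>The polynomial ring \<open>K[x\<^sub>0, x\<^sub>1, x\<^sub>2]\<close>: a monomial is its exponent vector.\<close>

type_synonym 'k poly3 = "(3 \<Rightarrow>\<^sub>0 nat) \<Rightarrow>\<^sub>0 'k"

definition Const3 :: "'k::zero \<Rightarrow> 'k poly3" where
  "Const3 c = Poly_Mapping.single 0 c"

definition Var3 :: "3 \<Rightarrow> 'k::zero_neq_one poly3" where
  "Var3 i = Poly_Mapping.single (Poly_Mapping.single i 1) 1"

text \<open>The zero polynomial counts as homogeneous of every degree.\<close>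

definition homogeneous3 :: "nat \<Rightarrow> 'k::zero poly3 \<Rightarrow> bool" where
  "homogeneous3 d p \<longleftrightarrow>
     (\<forall>m\<in>Poly_Mapping.keys p. (\<Sum>i\<in>UNIV. Poly_Mapping.lookup m i) = d)"

definition hesse_poly :: "'k::comm_ring_1 \<Rightarrow> 'k poly3" where
  "hesse_poly lam = hesse (Const3 lam) (\<chi> i. Var3 i)"

definition linear_det_rep :: "'k::field \<Rightarrow> 'k poly3^3^3 \<Rightarrow> bool" where
  "linear_det_rep lam M \<longleftrightarrow>
     (\<forall>i j. homogeneous3 1 (M$i$j)) \<and>
     (\<exists>c. c \<noteq> 0 \<and> det M = Const3 c * hesse_poly lam)"

definition equivalent_rep :: "'k::field poly3^3^3 \<Rightarrow> 'k poly3^3^3 \<Rightarrow> bool" where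
  "equivalent_rep M M' \<longleftrightarrow>
     (\<exists>P Q :: 'k^3^3. invertible P \<and> invertible Q \<and>
        M' = map_matrix Const3 P ** M ** map_matrix Const3 (matrix_inv Q))"

definition moore_matrix :: "'k::comm_ring_1^3 \<Rightarrow> 'k poly3^3^3" where
  "moore_matrix a = (\<chi> i j. Const3 (a$(i + j)) * Var3 (i - j))"

lemma moore_matrix_rows:
  "moore_matrix a = (let A = (\<lambda>i. Const3 (a$i)); x = Var3 in
     vec3 (vec3 (A 0 * x 0) (A 1 * x 2) (A 2 * x 1))
          (vec3 (A 1 * x 1) (A 2 * x 0) (A 0 * x 2))
          (vec3 (A 2 * x 2) (A 0 * x 1) (A 1 * x 0)))"
proof -
  have mod3: "- 1 = (2 :: 3)" "- 2 = (1 :: 3)" "3 = (0 :: 3)" "4 = (1 :: 3)"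
    by simp_all
  have three: "i = 0 \<or> i = 1 \<or> i = 2" for i :: 3
    using exhaust_3[of i] by auto
  have "moore_matrix a $ i $ j =
          vec3 (vec3 (Const3 (a$0) * Var3 0) (Const3 (a$1) * Var3 2) (Const3 (a$2) * Var3 1))
          (vec3 (Const3 (a$1) * Var3 1) (Const3 (a$2) * Var3 0) (Const3 (a$0) * Var3 2))
          (vec3 (Const3 (a$2) * Var3 2) (Const3 (a$0) * Var3 1) (Const3 (a$1) * Var3 0)) $ i $ j" for i j
    using three[of i] three[of j] by (auto simp: moore_matrix_def vec3_def mod3)
  then show ?thesis
    by (simp add: vec_eq_iff Let_def)
qed


section \<open>The curve and its group law\<close>

text \<open>
  A point of the projective plane is the class of all nonzero multiples of a nonzero vector.
\<close>

definition proj_pt :: "'k::field^3 \<Rightarrow> ('k^3) set" where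
  "proj_pt x = {c *s x |c. c \<noteq> 0}"

definition hesse_curve :: "'k::field \<Rightarrow> ('k^3) set set" where
  "hesse_curve lam = {proj_pt x |x. x \<noteq> 0 \<and> hesse lam x = 0}"

definition proj_line :: "'k::field^3 \<Rightarrow> ('k^3) set set" where
  "proj_line l = {proj_pt x |x. x \<noteq> 0 \<and> (\<Sum>i\<in>UNIV. l$i * x$i) = 0}"

text \<open>
  The intersection multiplicity at \<open>[x]\<close> of the curve with the line through \<open>[x]\<close> and
  \<open>[v]\<close>, for \<open>[v]\<close> different from \<open>[x]\<close>: the order of vanishing at \<open>t = 0\<close> of the cubic
  evaluated at \<open>x + t v\<close>. It depends only on the point \<open>[x]\<close> and on the line. The polynomial
  is nonzero because a smooth plane cubic contains no line.
\<close>

definition line_mult :: "'k::field \<Rightarrow> 'k^3 \<Rightarrow> 'k^3 \<Rightarrow> nat" where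
  "line_mult lam x v = order 0 (hesse [:lam:] (\<chi> i. [:x$i, v$i:]))"

text \<open>
  \<open>line_section lam P Q R\<close>: some line cuts out the divisor \<open>P + Q + R\<close> on the curve,
  multiplicities included.
\<close>

definition line_section ::
    "'k::field \<Rightarrow> ('k^3) set \<Rightarrow> ('k^3) set \<Rightarrow> ('k^3) set \<Rightarrow> bool" where
  "line_section lam P Q R \<longleftrightarrow>
     (\<exists>l. l \<noteq> 0 \<and> {P, Q, R} \<subseteq> proj_line l \<and>
        (\<forall>x v. proj_pt x \<in> proj_line l \<and> proj_pt v \<in> proj_line l \<and> proj_pt x \<noteq> proj_pt v \<longrightarrow>
           line_mult lam x v = count {#P, Q, R#} (proj_pt x)))"

text \<open>
  Chord-tangent construction: \<open>third_point\<close> is the residual intersection point of the line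
  through \<open>P\<close> and \<open>Q\<close> (the tangent line if \<open>P = Q\<close>), which is unique on the smooth curve.
\<close>

definition third_point ::
    "'k::field \<Rightarrow> ('k^3) set \<Rightarrow> ('k^3) set \<Rightarrow> ('k^3) set" where
  "third_point lam P Q = (THE R. line_section lam P Q R)"

definition curve_zero :: "('k::field^3) set" where
  "curve_zero = proj_pt (vec3 0 (- 1) 1)"

definition curve_add ::
    "'k::field \<Rightarrow> ('k^3) set \<Rightarrow> ('k^3) set \<Rightarrow> ('k^3) set" where
  "curve_add lam P Q = third_point lam curve_zero (third_point lam P Q)"

definition curve_triple :: "'k::field \<Rightarrow> ('k^3) set \<Rightarrow> ('k^3) set" where
  "curve_triple lam P = curve_add lam (curve_add lam P P) P"

end

theory Submission
  imports Defs
begin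

text \<open>
  Let \<open>o\<close> be the flex \<open>[0:-1:1]\<close> and let \<open>M\<close> be a representation. If \<open>w\<close> spans the left kernel of
  \<open>M(o)\<close>, the matrix of the linear forms \<open>w M(x)\<close> has a one-dimensional right kernel, spanned by some
  \<open>u\<close>, and \<open>M(q) u = 0\<close> for exactly one point \<open>q\<close>. In coordinates in which the cubic is in
  Weierstrass form, row and column operations bring \<open>M\<close> into a normal form whose two parameters are
  the affine coordinates of \<open>q\<close>; hence \<open>q \<noteq> o\<close> is a complete invariant of \<open>M\<close> up to equivalence.
  For the Moore matrix of \<open>a\<close>, \<open>u\<close> is \<open>2a\<close> and \<open>q\<close> is \<open>3a\<close>. Tripling is onto \<open>E - {o}\<close> because it is
  the composition of two isogenies of degree 3, each of which is, after a linear change of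
  coordinates, the map that cubes the coordinates.
\<close>


text \<open>Behind the invariant stands a classical correspondence: up to a twist, the cokernel of
  \<open>M\<close> is a nontrivial line bundle of degree 0 on the curve, and such bundles correspond
  to the points other than \<open>o\<close>. The elementary version works because row and column
  operations change \<open>w\<close> and \<open>u\<close> but not the variables, hence neither
  \<open>o\<close> nor \<open>q\<close>. It matters that \<open>o\<close> is a flex: the tangent
  there meets the cubic only in \<open>o\<close>, so with this tangent as a coordinate few
  coefficients survive, and comparing them with those of a determinant fixes all but two parameters.
  Identities of polynomials are read off from values, hence the infinite field. The group law enters
  through explicit vectors for \<open>-2a\<close>, \<open>2a\<close>, \<open>-3a\<close> and
  \<open>3a\<close>; the vector found from the kernels of the Moore matrix has to agree with the one
  that chords and tangents deliver. The delicate points are the degenerate cases, in which a formula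
  could produce the zero vector or a chord could collapse. They are excluded by smoothness and by
  \<open>a0 a1 a2 \<noteq> 0\<close>, which says that \<open>a\<close> is not one of the nine
  flexes.\<close>

lemma UNIV_three: "(UNIV :: 3 set) = {0, 1, 2}"
proof -
  have "(3::3) = 0" by simp
  then show ?thesis unfolding UNIV_3 by auto
qed

lemma sum_three: "sum f (UNIV :: 3 set) = f 0 + f 1 + f 2"
  unfolding UNIV_three by (simp add: add.assoc)

lemma forall_three: "(\<forall>i::3. P i) \<longleftrightarrow> P 0 \<and> P 1 \<and> P 2"
  by (metis UNIV_I UNIV_three insert_iff singletonD)

lemma vec3_nth [simp]: "vec3 a b c $ 0 = a" "vec3 a b c $ 1 = b" "vec3 a b c $ 2 = c"
  by (simp_all add: vec3_def)

lemma vec_eq_three: "x = y \<longleftrightarrow> x$0 = y$0 \<and> x$1 = y$1 \<and> x$2 = (y$2 :: 'a)" for x y :: "'a^3"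
  by (simp add: vec_eq_iff forall_three)

lemma det_three:
  fixes A :: "'a::comm_ring_1^3^3"
  shows "det A = A$0$0 * (A$1$1 * A$2$2 - A$1$2 * A$2$1)
    - A$0$1 * (A$1$0 * A$2$2 - A$1$2 * A$2$0) + A$0$2 * (A$1$0 * A$2$1 - A$1$1 * A$2$0)"
proof -
  have *: "(3::3) = 0" by simp
  show ?thesis unfolding det_3 * by (simp add: algebra_simps)
qed

section \<open>Ternary polynomials\<close>

lemma Const3_add: "Const3 (a + b) = Const3 a + Const3 b"
  by (simp add: Const3_def single_add)

lemma Const3_0 [simp]: "Const3 0 = 0"
  by (simp add: Const3_def)

lemma Const3_1 [simp]: "Const3 1 = 1"
  by (simp add: Const3_def)

lemma Const3_uminus: "Const3 (- a) = - Const3 (a :: 'a::comm_ring_1)"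
  by (simp add: Const3_def single_uminus)

lemma Const3_mult: "Const3 (a * b) = Const3 a * Const3 (b :: 'a::comm_ring_1)"
  by (simp add: Const3_def mult_single)

lemma Const3_power: "Const3 (a ^ n) = Const3 (a :: 'a::comm_ring_1) ^ n"
  by (induction n) (simp_all add: Const3_mult)

text \<open>This reduces multiplicativity of evaluation to pairs of monomials.\<close>

lemma poly_mapping_single_induct [case_names zero single add]:
  assumes "P 0" "\<And>m c. P (Poly_Mapping.single m c)" "\<And>p q. P p \<Longrightarrow> P q \<Longrightarrow> P (p + q)"
  shows "P (p :: 'a \<Rightarrow>\<^sub>0 'b::comm_monoid_add)"
proof (induction p rule: update_induct)
  case const
  show ?case by fact
next
  case (update f a b)
  have "Poly_Mapping.update a b f = f + Poly_Mapping.single a b"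
    using update by (intro poly_mapping_eqI)
      (auto simp: lookup_update lookup_add lookup_single in_keys_iff when_def)
  with update assms show ?case by metis
qed

definition eval_poly3 :: "'k::comm_ring_1^3 \<Rightarrow> 'k poly3 \<Rightarrow> 'k" where
  "eval_poly3 x p = (\<Sum>m\<in>Poly_Mapping.keys p.
     Poly_Mapping.lookup p m * (\<Prod>i\<in>UNIV. x$i ^ Poly_Mapping.lookup m i))"

text \<open>Cancellation can make the support of a sum smaller than the union of the supports.
  Summing over a common finite superset gives all terms the same index set.\<close>

lemma eval_poly3_superset:
  assumes "finite S" "Poly_Mapping.keys p \<subseteq> S"
  shows "eval_poly3 x p =
    (\<Sum>m\<in>S. Poly_Mapping.lookup p m * (\<Prod>i\<in>UNIV. x$i ^ Poly_Mapping.lookup m i))"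
  unfolding eval_poly3_def using assms
  by (intro sum.mono_neutral_left) (auto simp: in_keys_iff)

lemma eval_poly3_0 [simp]: "eval_poly3 x 0 = 0"
  by (simp add: eval_poly3_def)

lemma eval_poly3_single [simp]:
  "eval_poly3 x (Poly_Mapping.single m c) = c * (\<Prod>i\<in>UNIV. x$i ^ Poly_Mapping.lookup m i)"
  by (subst eval_poly3_superset[where S="{m}"]) auto

lemma eval_poly3_add [simp]: "eval_poly3 x (p + q) = eval_poly3 x p + eval_poly3 x q"
proof -
  let ?S = "Poly_Mapping.keys p \<union> Poly_Mapping.keys q"
  have "finite ?S" "Poly_Mapping.keys (p + q) \<subseteq> ?S" by (use Poly_Mapping.keys_add[of p q] in auto)
  then show ?thesis
    by (simp add: eval_poly3_superset[where S="?S"] lookup_add distrib_right sum.distrib)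
qed

lemma eval_poly3_mult [simp]: "eval_poly3 x (p * q) = eval_poly3 x p * eval_poly3 x q"
proof (induction p rule: poly_mapping_single_induct)
  case (single m c)
  show ?case
  proof (induction q rule: poly_mapping_single_induct)
    case (single m' c')
    show ?case
      by (simp add: mult_single lookup_add power_add prod.distrib mult_ac)
  qed (simp_all add: distrib_left)
qed (simp_all add: distrib_right)

lemma eval_poly3_Const3 [simp]: "eval_poly3 x (Const3 c) = c"
  by (simp add: Const3_def)

lemma eval_poly3_1 [simp]: "eval_poly3 x 1 = 1"
  using eval_poly3_Const3[of x 1] by simp

lemma eval_poly3_Var3 [simp]: "eval_poly3 x (Var3 k) = x$k"
proof -
  have "(\<Prod>i\<in>UNIV. x$i ^ Poly_Mapping.lookup (Poly_Mapping.single k 1) i) =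
      (\<Prod>i\<in>UNIV. if i = k then x$i else 1)"
    by (intro prod.cong) (auto simp: lookup_single when_def)
  then show ?thesis by (simp add: Var3_def)
qed

lemma eval_poly3_uminus [simp]: "eval_poly3 x (- p) = - eval_poly3 x p"
  using eval_poly3_add[of x p "- p"] by (simp del: eval_poly3_add add: eq_neg_iff_add_eq_0 add.commute)

lemma eval_poly3_diff [simp]: "eval_poly3 x (p - q) = eval_poly3 x p - eval_poly3 x q"
  using eval_poly3_add[of x p "- q"] by simp

lemma eval_poly3_power [simp]: "eval_poly3 x (p ^ n) = eval_poly3 x p ^ n"
  by (induction n) simp_all

lemma eval_poly3_sum [simp]: "eval_poly3 x (sum f S) = (\<Sum>i\<in>S. eval_poly3 x (f i))"
  by (induction S rule: infinite_finite_induct) simp_all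

lemma eval_hesse_poly: "eval_poly3 x (hesse_poly lam) = hesse lam x"
  by (simp add: hesse_poly_def hesse_def)

lemma eval_det:
  fixes M :: "'k::comm_ring_1 poly3^3^3"
  shows "eval_poly3 x (det M) = det (map_matrix (eval_poly3 x) M)"
  by (simp add: det_three map_matrix_def)

section \<open>Pencils of matrices\<close>

definition linform :: "'k::comm_ring_1^3 \<Rightarrow> 'k poly3" where
  "linform v = (\<Sum>k\<in>UNIV. Const3 (v$k) * Var3 k)"

lemma linform_add: "linform (v + w) = linform v + linform w"
  by (simp add: linform_def Const3_add distrib_right sum.distrib)

lemma linform_scale: "linform (c *s v) = Const3 c * linform v"
  by (simp add: linform_def Const3_mult sum_distrib_left mult.assoc)

lemma sum_eq_1_single:
  fixes m :: "3 \<Rightarrow>\<^sub>0 nat"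
  assumes "(\<Sum>i\<in>UNIV. Poly_Mapping.lookup m i) = 1"
  shows "\<exists>k. m = Poly_Mapping.single k 1"
proof -
  from assms obtain k where k: "Poly_Mapping.lookup m k = 1" "\<forall>i\<in>UNIV. i \<noteq> k \<longrightarrow> Poly_Mapping.lookup m i = 0"
    by (subst (asm) sum_eq_1_iff) auto
  have "m = Poly_Mapping.single k 1"
    using k by (intro poly_mapping_eqI) (auto simp: lookup_single when_def)
  then show ?thesis ..
qed

lemma single_1_inj: "Poly_Mapping.single k (1::nat) = Poly_Mapping.single j 1 \<longleftrightarrow> k = j"
  by (metis lookup_single_eq lookup_single_not_eq zero_neq_one)

lemma Const3_mult_Var3: "Const3 (c :: 'a::comm_ring_1) * Var3 k = Poly_Mapping.single (Poly_Mapping.single k 1) c"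
  by (simp add: Const3_def Var3_def mult_single)

lemma homogeneous3_1_linform:
  assumes "homogeneous3 1 (p :: 'k::comm_ring_1 poly3)"
  shows "p = linform (\<chi> k. Poly_Mapping.lookup p (Poly_Mapping.single k 1))"
proof (intro poly_mapping_eqI)
  fix m
  let ?v = "\<chi> k. Poly_Mapping.lookup p (Poly_Mapping.single k 1)"
  have *: "Poly_Mapping.lookup (linform ?v) m =
      (\<Sum>k\<in>UNIV. if Poly_Mapping.single k 1 = m then ?v $ k else 0)"
    unfolding linform_def lookup_sum Const3_mult_Var3 lookup_single when_def ..
  show "Poly_Mapping.lookup p m = Poly_Mapping.lookup (linform ?v) m"
  proof (cases "\<exists>k. m = Poly_Mapping.single k 1")
    case True
    then obtain k where k: "m = Poly_Mapping.single k 1" ..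
    show ?thesis using * unfolding k single_1_inj by simp
  next
    case False
    then have "m \<notin> Poly_Mapping.keys p"
      using assms sum_eq_1_single unfolding homogeneous3_def by blast
    moreover have "Poly_Mapping.lookup (linform ?v) m = 0"
      unfolding * using False by (intro sum.neutral) auto
    ultimately show ?thesis by (simp add: in_keys_iff)
  qed
qed

lemma homogeneous3_single:
  "homogeneous3 1 (Poly_Mapping.single (Poly_Mapping.single k 1) c)"
  by (auto simp: homogeneous3_def lookup_single when_def sum_eq_1_iff)

text \<open>A matrix of linear forms is encoded by its coefficients, \<open>A$i$j\<close> being the
  coefficient vector of the entry \<open>(i, j)\<close>. It can then be studied through the scalar
  matrices \<open>pencil_at A x\<close>.\<close>

definition pencil_poly :: "'k::comm_ring_1^3^3^3 \<Rightarrow> 'k poly3^3^3" where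
  "pencil_poly A = (\<chi> i j. linform (A$i$j))"

definition pencil_at :: "'k::comm_ring_1^3^3^3 \<Rightarrow> 'k^3 \<Rightarrow> 'k^3^3" where
  "pencil_at A x = (\<chi> i j. \<Sum>k\<in>UNIV. A$i$j$k * x$k)"

definition pencil_trans :: "'k::comm_ring_1^3^3 \<Rightarrow> 'k^3^3 \<Rightarrow> 'k^3^3^3 \<Rightarrow> 'k^3^3^3" where
  "pencil_trans P Q A = (\<chi> i j. \<Sum>a\<in>UNIV. \<Sum>b\<in>UNIV. (P$i$a * Q$b$j) *s A$a$b)"

text \<open>In contrast to \<open>equivalent_rep\<close>, the right factor is not inverted; since it
  ranges over all invertible matrices, the relation is the same.\<close>

definition pencil_equiv :: "'k::field^3^3^3 \<Rightarrow> 'k^3^3^3 \<Rightarrow> bool" where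
  "pencil_equiv A B \<longleftrightarrow> (\<exists>P Q. invertible P \<and> invertible Q \<and> B = pencil_trans P Q A)"

lemma eval_pencil_poly: "map_matrix (eval_poly3 x) (pencil_poly A) = pencil_at A x"
  by (simp add: map_matrix_def pencil_poly_def pencil_at_def linform_def)

lemma pencil_poly_trans:
  "map_matrix Const3 P ** pencil_poly A ** map_matrix Const3 Q = pencil_poly (pencil_trans P Q A)"
  by (simp add: vec_eq_iff matrix_matrix_mult_def map_matrix_def pencil_poly_def pencil_trans_def
      forall_three sum_three linform_add linform_scale Const3_mult algebra_simps)

lemma pencil_at_trans: "pencil_at (pencil_trans P Q A) x = P ** pencil_at A x ** Q"
  by (simp add: vec_eq_iff matrix_matrix_mult_def pencil_at_def pencil_trans_def
      forall_three sum_three algebra_simps)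

lemma pencil_at_axis: "pencil_at A (axis k 1) $ i $ j = A$i$j$k"
  by (simp add: pencil_at_def axis_def if_distrib[where f="\<lambda>x. _ * x"] cong: if_cong)

lemma pencil_eqI: "(\<And>x. pencil_at A x = pencil_at B x) \<Longrightarrow> A = B"
  unfolding vec_eq_iff by (metis pencil_at_axis)

lemma pencil_equiv_trans:
  assumes "pencil_equiv A B" "pencil_equiv B C"
  shows "pencil_equiv A C"
proof -
  from assms obtain P Q P' Q' where inv: "invertible P" "invertible Q" "invertible P'" "invertible Q'"
    and eq: "B = pencil_trans P Q A" "C = pencil_trans P' Q' B"
    unfolding pencil_equiv_def by blast
  have "C = pencil_trans (P' ** P) (Q ** Q') A"
    by (rule pencil_eqI) (simp add: eq pencil_at_trans matrix_mul_assoc)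
  with inv show ?thesis unfolding pencil_equiv_def by (metis invertible_mult)
qed

lemma pencil_equiv_sym:
  assumes "pencil_equiv A B"
  shows "pencil_equiv B A"
proof -
  from assms obtain P Q where inv: "invertible P" "invertible Q" and eq: "B = pencil_trans P Q A"
    unfolding pencil_equiv_def by blast
  from inv obtain P' Q' where PQ: "P' ** P = mat 1" "P ** P' = mat 1" "Q ** Q' = mat 1" "Q' ** Q = mat 1"
    unfolding invertible_def by blast
  have "A = pencil_trans P' Q' B"
  proof (rule pencil_eqI)
    fix x
    have "pencil_at (pencil_trans P' Q' B) x = (P' ** P) ** pencil_at A x ** (Q ** Q')"
      by (simp only: eq pencil_at_trans matrix_mul_assoc)
    then show "pencil_at A x = pencil_at (pencil_trans P' Q' B) x" by (simp add: PQ)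
  qed
  with PQ show ?thesis unfolding pencil_equiv_def invertible_def by blast
qed

lemma invertible_matrix_inv: 
  assumes "invertible (Q :: 'a::semiring_1^'n^'n)"
  shows "Q ** matrix_inv Q = mat 1" "matrix_inv Q ** Q = mat 1"
  using someI_ex[OF assms[unfolded invertible_def]] unfolding matrix_inv_def by auto

lemma equivalent_rep_pencil_poly: "equivalent_rep (pencil_poly A) (pencil_poly B) \<longleftrightarrow> pencil_equiv A B"
proof
  assume "equivalent_rep (pencil_poly A) (pencil_poly B)"
  then obtain P Q where inv: "invertible P" "invertible Q"
    and eq: "pencil_poly B = map_matrix Const3 P ** pencil_poly A ** map_matrix Const3 (matrix_inv Q)"
    unfolding equivalent_rep_def by blast
  have "B = pencil_trans P (matrix_inv Q) A"
    by (rule pencil_eqI) (metis eq eval_pencil_poly pencil_poly_trans)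
  moreover have "invertible (matrix_inv Q)"
    using invertible_matrix_inv[OF inv(2)] unfolding invertible_def by blast
  ultimately show "pencil_equiv A B" using inv unfolding pencil_equiv_def by blast
next
  assume "pencil_equiv A B"
  then obtain P Q where inv: "invertible P" "invertible Q" and eq: "B = pencil_trans P Q A"
    unfolding pencil_equiv_def by blast
  let ?R = "matrix_inv Q"
  have R: "invertible ?R"
    using invertible_matrix_inv[OF inv(2)] unfolding invertible_def by blast
  have "matrix_inv ?R = (Q ** ?R) ** matrix_inv ?R"
    using invertible_matrix_inv[OF inv(2)] by simp
  also have "\<dots> = Q"
    using invertible_matrix_inv[OF R] by (simp add: matrix_mul_assoc[symmetric])
  finally have "pencil_poly B = map_matrix Const3 P ** pencil_poly A ** map_matrix Const3 (matrix_inv ?R)"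
    by (simp add: eq pencil_poly_trans)
  with inv R show "equivalent_rep (pencil_poly A) (pencil_poly B)"
    unfolding equivalent_rep_def by blast
qed

lemma linear_det_rep_pencil:
  assumes "linear_det_rep lam M"
  obtains A where "M = pencil_poly A"
proof
  show "M = pencil_poly (\<chi> i j k. Poly_Mapping.lookup (M$i$j) (Poly_Mapping.single k 1))"
    using assms homogeneous3_1_linform
    unfolding linear_det_rep_def pencil_poly_def by (auto simp: vec_eq_iff simp del: One_nat_def)
qed

section \<open>Normal form of a determinantal representation of a cubic in Weierstrass form\<close>

lemma cubic_coeffs_0:
  fixes a b c d :: "'k::field"
  assumes "infinite (UNIV :: 'k set)" "\<And>x. a + b * x + c * x^2 + d * x^3 = 0"
  shows "a = 0" "b = 0" "c = 0" "d = 0"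
proof -
  have "poly [:a, b, c, d:] x = 0" for x
    using assms(2)[of x] by (simp add: algebra_simps power2_eq_square power3_eq_cube)
  then have "[:a, b, c, d:] = 0"
    using assms(1) poly_roots_finite[of "[:a, b, c, d:]"] by auto
  then show "a = 0" "b = 0" "c = 0" "d = 0" by simp_all
qed

text \<open>At \<open>t = 1\<close> the ten monomials stay distinct, so the coefficients can be
  separated by powers of \<open>n\<close> and then by powers of \<open>l\<close>.\<close>

lemma ternary_cubic_coeffs_0:
  fixes c1 :: "'k::field"
  assumes inf: "infinite (UNIV :: 'k set)"
    and *: "\<And>t l n. c1 * t^3 + c2 * t^2 * l + c3 * t * l^2 + c4 * l^3 + c5 * t^2 * n + c6 * t * l * n
      + c7 * l^2 * n + c8 * t * n^2 + c9 * l * n^2 + c10 * n^3 = 0"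
  shows "c1 = 0" "c2 = 0" "c3 = 0" "c4 = 0" "c5 = 0" "c6 = 0" "c7 = 0" "c8 = 0" "c9 = 0" "c10 = 0"
proof -
  have n: "(c1 + c2 * l + c3 * l^2 + c4 * l^3) + (c5 + c6 * l + c7 * l^2) * n
      + (c8 + c9 * l) * n^2 + c10 * n^3 = 0" for l n
    using *[of 1 l n] by (simp add: algebra_simps)
  have "c1 + c2 * l + c3 * l^2 + c4 * l^3 = 0" for l
    by (rule cubic_coeffs_0(1)[OF inf n])
  from cubic_coeffs_0[OF inf this] show "c1 = 0" "c2 = 0" "c3 = 0" "c4 = 0" by auto
  have "c5 + c6 * l + c7 * l^2 + 0 * l^3 = 0" for l
    using cubic_coeffs_0(2)[OF inf n] by simp
  from cubic_coeffs_0[OF inf this] show "c5 = 0" "c6 = 0" "c7 = 0" by auto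
  have "c8 + c9 * l + 0 * l^2 + 0 * l^3 = 0" for l
    using cubic_coeffs_0(3)[OF inf n] by simp
  from cubic_coeffs_0[OF inf this] show "c8 = 0" "c9 = 0" by auto
  show "c10 = 0" by (rule cubic_coeffs_0(4)[OF inf n])
qed

lemma ex_invertible_column:
  fixes v :: "'k::field^3"
  assumes "v \<noteq> 0"
  shows "\<exists>Q :: 'k^3^3. invertible Q \<and> (\<forall>i. Q$i$0 = v$i)"
proof -
  consider "v$0 \<noteq> 0" | "v$1 \<noteq> 0" | "v$2 \<noteq> 0" using assms by (auto simp: vec_eq_three)
  then show ?thesis
  proof cases
    case 1
    then show ?thesis
      by (intro exI[of _ "vec3 (vec3 (v$0) 0 0) (vec3 (v$1) 1 0) (vec3 (v$2) 0 1)"])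
        (auto simp: invertible_det_nz det_three forall_three)
  next
    case 2
    then show ?thesis
      by (intro exI[of _ "vec3 (vec3 (v$0) 1 0) (vec3 (v$1) 0 0) (vec3 (v$2) 0 1)"])
        (auto simp: invertible_det_nz det_three forall_three)
  next
    case 3
    then show ?thesis
      by (intro exI[of _ "vec3 (vec3 (v$0) 1 0) (vec3 (v$1) 0 1) (vec3 (v$2) 0 0)"])
        (auto simp: invertible_det_nz det_three forall_three)
  qed
qed

lemma ex_kernel_vector:
  fixes M :: "'k::field^'n^'n"
  assumes "det M = 0"
  shows "\<exists>v. v \<noteq> 0 \<and> M *v v = 0"
  using assms invertible_det_nz[of M] matrix_left_invertible_ker[of M]
  by (metis invertible_left_inverse)

text \<open>On the line \<open>y0 = 0\<close> only \<open>k y1^3\<close> remains, so for nonzero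
  \<open>n\<close> and \<open>k\<close> the point \<open>(0, 0, 1)\<close> is a flex with this
  tangent.\<close>

definition weier :: "'k::comm_ring_1 \<Rightarrow> 'k \<Rightarrow> 'k \<Rightarrow> 'k \<Rightarrow> 'k \<Rightarrow> 'k^3 \<Rightarrow> 'k" where
  "weier n k al be ga y =
     n * y$0 * (y$2)^2 + k * (y$1)^3 + al * (y$0)^3 + be * (y$0)^2 * y$1 + ga * y$0 * (y$1)^2"

text \<open>With variables \<open>T, L, N\<close> the rows are \<open>(T, L, 0)\<close>,
  \<open>(L, *, b T + N)\<close> and \<open>(0, (n/k) (N - b T), d T + L)\<close>. The determinant
  agrees with \<open>-1/k\<close> times the Weierstrass cubic in every coefficient except possibly
  that of \<open>T^3\<close>; agreement there says that \<open>(1, -d, -b)\<close> lies on the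
  cubic, and this is how \<open>al\<close> enters.\<close>

definition weier_pencil :: "'k::field \<Rightarrow> 'k \<Rightarrow> 'k \<Rightarrow> 'k \<Rightarrow> 'k \<Rightarrow> 'k \<Rightarrow> 'k^3^3^3" where
  "weier_pencil n k be ga b d =
     vec3 (vec3 (vec3 1 0 0) (vec3 0 1 0) 0)
          (vec3 (vec3 0 1 0) (vec3 (- be / k - (d - ga / k) * d) (d - ga / k) 0) (vec3 b 0 1))
          (vec3 0 (vec3 (- n * b / k) 0 (n / k)) (vec3 d 1 0))"

definition det_rep_of :: "('k::field^3 \<Rightarrow> 'k) \<Rightarrow> 'k^3^3^3 \<Rightarrow> bool" where
  "det_rep_of F A \<longleftrightarrow> (\<exists>c. c \<noteq> 0 \<and> (\<forall>y. det (pencil_at A y) = c * F y))"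

lemma det_rep_of_equiv:
  assumes "det_rep_of F A" "pencil_equiv A B"
  shows "det_rep_of F B"
proof -
  from assms(1) obtain c where c: "c \<noteq> 0" "\<And>y. det (pencil_at A y) = c * F y"
    unfolding det_rep_of_def by blast
  from assms(2) obtain P Q where PQ: "det P \<noteq> 0" "det Q \<noteq> 0" "B = pencil_trans P Q A"
    unfolding pencil_equiv_def by (auto simp: invertible_det_nz)
  have "det (pencil_at B y) = (det P * c * det Q) * F y" for y
    by (simp add: PQ(3) pencil_at_trans det_mul c)
  with c PQ show ?thesis unfolding det_rep_of_def by (intro exI[of _ "det P * c * det Q"]) simp
qed

lemma pencil_equivI:
  "det P \<noteq> 0 \<Longrightarrow> det Q \<noteq> 0 \<Longrightarrow> pencil_equiv A (pencil_trans P Q A)"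
  unfolding pencil_equiv_def by (auto simp: invertible_det_nz)

text \<open>The matrix is singular at the flex \<open>(0, 0, 1)\<close>. A right and a left kernel
  vector there, completed to bases, remove the last variable from the first column and the first
  row.\<close>

lemma normal_form_step1:
  fixes A :: "'k::field^3^3^3"
  assumes "det_rep_of (weier n k al be ga) A"
  shows "\<exists>B. pencil_equiv A B \<and> (\<forall>i. B$i$0$2 = 0) \<and> (\<forall>i. B$0$i$2 = 0)"
proof -
  let ?M = "pencil_at A (axis 2 1)"
  have "weier n k al be ga (axis 2 1) = 0" by (simp add: weier_def axis_def)
  then have 0: "det ?M = 0" using assms unfolding det_rep_of_def by auto
  obtain v where v: "v \<noteq> 0" "?M *v v = 0" using ex_kernel_vector[OF 0] by blast
  obtain w where w: "w \<noteq> 0" "transpose ?M *v w = 0"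
    using ex_kernel_vector[of "transpose ?M"] 0 by (auto simp: det_transpose)
  obtain Q :: "'k^3^3" where Q: "invertible Q" "\<And>i. Q$i$0 = v$i" using ex_invertible_column[OF v(1)] by blast
  obtain P :: "'k^3^3" where P: "invertible P" "\<And>i. P$i$0 = w$i" using ex_invertible_column[OF w(1)] by blast
  let ?B = "pencil_trans (transpose P) Q A"
  have B: "?B$i$j$2 = (transpose P ** ?M ** Q)$i$j" for i j
    by (simp add: pencil_at_axis[symmetric] pencil_at_trans)
  have "(?M ** Q)$i$0 = 0" for i
    using v(2) by (simp add: matrix_matrix_mult_def Q vec_eq_iff matrix_vector_mult_def)
  then have "?B$i$0$2 = 0" for i
    unfolding B matrix_mul_assoc[symmetric] unfolding matrix_matrix_mult_def[of "transpose P"] by simp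
  moreover have "(transpose P ** ?M)$0$i = 0" for i
    using w(2) by (simp add: matrix_matrix_mult_def P vec_eq_iff matrix_vector_mult_def transpose_def mult.commute)
  then have "?B$0$i$2 = 0" for i
    unfolding B matrix_matrix_mult_def[of _ Q] by simp
  moreover have "pencil_equiv A ?B"
    using P Q by (intro pencil_equivI) (auto simp: invertible_det_nz det_transpose)
  ultimately show ?thesis by blast
qed

lemma Bezout_field:
  assumes "a \<noteq> 0 \<or> b \<noteq> (0::'k::field)"
  shows "\<exists>x y. x * a + y * b = 1"
proof (cases "a = 0")
  case True
  then show ?thesis using assms by (intro exI[of _ 0] exI[of _ "1 / b"]) simp
next
  case False
  then show ?thesis by (intro exI[of _ 0] exI[of _ "1 / a"]) simp
qed

lemma normal_form_step2:
  fixes A :: "'k::field^3^3^3"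
  assumes det: "det_rep_of (weier n k al be ga) A" and nz: "(2::'k) \<noteq> 0" "n \<noteq> 0" "k \<noteq> 0"
    and A: "\<And>i. A$i$0$2 = 0" "\<And>i. A$0$i$2 = 0"
  shows "\<exists>B. pencil_equiv A B \<and> B$0$0 = vec3 1 0 0 \<and> B$1$0 = vec3 0 1 0 \<and> B$2$0 = 0 \<and>
    B$0$1$2 = 0 \<and> B$0$2$2 = 0"
proof -
  obtain c where c: "c \<noteq> 0" "\<And>y. det (pencil_at A y) = c * weier n k al be ga y"
    using det unfolding det_rep_of_def by blast
  define p q s1 l1 s2 l2 where "p = A$0$0$0" "q = A$0$0$1" "s1 = A$1$0$0" "l1 = A$1$0$1" "s2 = A$2$0$0" "l2 = A$2$0$1"
  note defs = this
  define mu where "mu = A$1$1$2 * A$2$2$2 - A$1$2$2 * A$2$1$2"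
  \<comment> \<open>The second difference in the last variable isolates twice its quadratic
    coefficient. Since the first row and column are free of that variable, the coefficient is the
    corner entry times a 2 by 2 minor; for the cubic it is a multiple of \<open>t\<close>.\<close>
  have eq: "2 * ((p * t + q * l) * mu) = 2 * (c * n * t)" for t l
  proof -
    have "2 * ((p * t + q * l) * mu) =
        det (pencil_at A (vec3 t l 1)) + det (pencil_at A (vec3 t l (-1))) - 2 * det (pencil_at A (vec3 t l 0))"
      by (simp add: det_three pencil_at_def sum_three A defs mu_def algebra_simps)
    also have "\<dots> = 2 * (c * n * t)"
      by (simp add: c weier_def algebra_simps)
    finally show ?thesis .
  qed
  have pmu: "p * mu = c * n" using eq[of 1 0] nz by simp
  then have p: "p \<noteq> 0" and mu: "mu \<noteq> 0" using c nz by auto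
  have q: "q = 0" using eq[of 0 1] nz mu by simp
  have "det (pencil_at A (vec3 0 1 0)) \<noteq> 0" using c nz by (simp add: weier_def)
  then have "l1 \<noteq> 0 \<or> l2 \<noteq> 0" using q by (auto simp: det_three pencil_at_def sum_three A defs)
  then obtain x y where xy: "x * l1 + y * l2 = 1" using Bezout_field by blast
  \<comment> \<open>The second and third rows are combined so that their first entries have
    \<open>L\<close>-coefficients 1 and 0; multiples of the first row, whose first entry is
    \<open>p T\<close>, then clear the \<open>T\<close> terms.\<close>
  define P where "P = vec3 (vec3 (1/p) 0 0) (vec3 (-(x * s1 + y * s2) / p) x y) (vec3 (-(l1 * s2 - l2 * s1) / p) (-l2) l1)"
  have "det P = (x * l1 + y * l2) / p" by (simp add: P_def det_three field_simps)
  then have dP: "det P \<noteq> 0" using xy p by simp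
  let ?B = "pencil_trans P (mat 1) A"
  have 1: "mat 1 $ i $ j = (if i = j then 1 else (0::'k))" for i j :: 3 by (simp add: mat_def)
  have "pencil_equiv A ?B" using dP by (intro pencil_equivI) auto
  moreover have "?B$0$0 = vec3 1 0 0"
    using p q by (simp add: vec_eq_three pencil_trans_def sum_three 1 P_def A defs)
  moreover have "?B$1$0 = vec3 0 1 0"
    using p q xy by (simp add: vec_eq_three pencil_trans_def sum_three 1 P_def A defs)
  moreover have "?B$2$0 = 0"
    using p q by (simp add: vec_eq_three pencil_trans_def sum_three 1 P_def A defs)
  moreover have "?B$0$1$2 = 0" "?B$0$2$2 = 0"
    by (simp_all add: pencil_trans_def sum_three 1 P_def A defs)
  ultimately show ?thesis by blast
qed

text \<open>The transposed argument, now for the first row. The first column of \<open>Q\<close> is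
  a unit vector, so the first column already normalised stays as it is.\<close>

lemma normal_form_step3:
  fixes A :: "'k::field^3^3^3"
  assumes det: "det_rep_of (weier n k al be ga) A" and nz: "k \<noteq> 0"
    and A: "A$0$0 = vec3 1 0 0" "A$1$0 = vec3 0 1 0" "A$2$0 = 0" "A$0$1$2 = 0" "A$0$2$2 = 0"
  shows "\<exists>B. pencil_equiv A B \<and> B$0$0 = vec3 1 0 0 \<and> B$1$0 = vec3 0 1 0 \<and> B$2$0 = 0 \<and>
    B$0$1 = vec3 0 1 0 \<and> B$0$2 = 0"
proof -
  obtain c where c: "c \<noteq> 0" "\<And>y. det (pencil_at A y) = c * weier n k al be ga y"
    using det unfolding det_rep_of_def by blast
  define s1 l1 s2 l2 where "s1 = A$0$1$0" "l1 = A$0$1$1" "s2 = A$0$2$0" "l2 = A$0$2$1"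
  note defs = this
  have "det (pencil_at A (vec3 0 1 0)) \<noteq> 0" using c nz by (simp add: weier_def)
  then have "l1 \<noteq> 0 \<or> l2 \<noteq> 0" by (auto simp: det_three pencil_at_def sum_three A defs)
  then obtain x y where xy: "x * l1 + y * l2 = 1" using Bezout_field by blast
  define Q where "Q = vec3 (vec3 1 (-(x * s1 + y * s2)) (-(l1 * s2 - l2 * s1))) (vec3 0 x (-l2)) (vec3 0 y l1)"
  have dQ: "det Q = 1" using xy by (simp add: Q_def det_three field_simps)
  let ?B = "pencil_trans (mat 1) Q A"
  have 1: "mat 1 $ i $ j = (if i = j then 1 else (0::'k))" for i j :: 3 by (simp add: mat_def)
  have "pencil_equiv A ?B" using dQ by (intro pencil_equivI) auto
  moreover have "?B$0$0 = vec3 1 0 0" "?B$1$0 = vec3 0 1 0" "?B$2$0 = 0"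
    by (simp_all add: vec_eq_three pencil_trans_def sum_three 1 Q_def A defs)
  moreover have "?B$0$1 = vec3 0 1 0" "?B$0$2 = 0"
    using xy by (simp_all add: vec_eq_three pencil_trans_def sum_three 1 Q_def A defs algebra_simps)
  ultimately show ?thesis by blast
qed

text \<open>For \<open>T = 0\<close> the determinant is \<open>-L^2\<close> times the last diagonal
  entry, while the cubic is \<open>k L^3\<close>. So this entry has a nonzero
  \<open>L\<close>-coefficient and no \<open>N\<close>, and it can be used as a pivot to clear
  \<open>L\<close> from its two neighbours.\<close>

lemma normal_form_step4:
  fixes A :: "'k::field^3^3^3"
  assumes det: "det_rep_of (weier n k al be ga) A" and nz: "k \<noteq> 0"
    and A: "A$0$0 = vec3 1 0 0" "A$1$0 = vec3 0 1 0" "A$2$0 = 0" "A$0$1 = vec3 0 1 0" "A$0$2 = 0"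
  shows "\<exists>B. pencil_equiv A B \<and> B$0$0 = vec3 1 0 0 \<and> B$1$0 = vec3 0 1 0 \<and> B$2$0 = 0 \<and>
    B$0$1 = vec3 0 1 0 \<and> B$0$2 = 0 \<and> B$2$2$1 = 1 \<and> B$2$2$2 = 0 \<and> B$1$2$1 = 0 \<and> B$2$1$1 = 0"
proof -
  obtain c where c: "c \<noteq> 0" "\<And>y. det (pencil_at A y) = c * weier n k al be ga y"
    using det unfolding det_rep_of_def by blast
  have *: "- (A$2$2$1 + A$2$2$2 * m) = c * k" for m
    using c(2)[of "vec3 0 1 m"] by (simp add: det_three pencil_at_def sum_three A weier_def)
  have D1: "A$2$2$1 \<noteq> 0" using *[of 0] c nz by auto
  have D2: "A$2$2$2 = 0" using *[of 0] *[of 1] by simp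
  define D where "D = A$2$2$1"
  define P where "P = vec3 (vec3 1 0 0) (vec3 0 1 (- A$1$2$1 / D)) (vec3 0 0 (1 / D))"
  define Q where "Q = vec3 (vec3 1 0 0) (vec3 0 1 0) (vec3 0 (- A$2$1$1 / D) 1)"
  have d: "det P \<noteq> 0" "det Q \<noteq> 0" using D1 by (simp_all add: P_def Q_def det_three D_def)
  let ?B = "pencil_trans P Q A"
  have "pencil_equiv A ?B" using d by (intro pencil_equivI)
  moreover have "?B$0$0 = vec3 1 0 0" "?B$1$0 = vec3 0 1 0" "?B$2$0 = 0" "?B$0$1 = vec3 0 1 0" "?B$0$2 = 0"
    "?B$2$2$1 = 1" "?B$2$2$2 = 0" "?B$1$2$1 = 0" "?B$2$1$1 = 0"
    using D1 by (simp_all add: vec_eq_three pencil_trans_def sum_three P_def Q_def A D2 D_def)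
  ultimately show ?thesis by blast
qed

lemma normal_form_step5:
  fixes A :: "'k::field^3^3^3"
  assumes inf: "infinite (UNIV :: 'k set)"
    and det: "det_rep_of (weier n k al be ga) A" and nz: "n \<noteq> 0" "k \<noteq> 0"
    and A: "A$0$0 = vec3 1 0 0" "A$1$0 = vec3 0 1 0" "A$2$0 = 0" "A$0$1 = vec3 0 1 0" "A$0$2 = 0"
      "A$2$2$1 = 1" "A$2$2$2 = 0" "A$1$2$1 = 0" "A$2$1$1 = 0"
  shows "\<exists>b d. pencil_equiv A (weier_pencil n k be ga b d)"
proof -
  obtain c where c: "c \<noteq> 0" "\<And>y. det (pencil_at A y) = c * weier n k al be ga y"
    using det unfolding det_rep_of_def by blast
  have ck: "c * k = -1"
    using c(2)[of "vec3 0 1 0"] by (simp add: det_three pencil_at_def sum_three A weier_def)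
  define aT aL aN b bN e g d where "aT = A$1$1$0" "aL = A$1$1$1" "aN = A$1$1$2"
    "b = A$1$2$0" "bN = A$1$2$2" "e = A$2$1$0" "g = A$2$1$2" "d = A$2$2$0"
  note defs = this
  have "(aT * d - b * e - c * al) * t^3 + (aT + aL * d - d * 0 - c * be) * t^2 * l
      + (aL - d - c * ga) * t * l^2 + (- 1 - c * k) * l^3
      + (aN * d - b * g - bN * e) * t^2 * m + aN * t * l * m + 0 * l^2 * m + (- bN * g - c * n) * t * m^2
      + 0 * l * m^2 + 0 * m^3 = det (pencil_at A (vec3 t l m)) - c * weier n k al be ga (vec3 t l m)" for t l m
    by (simp add: det_three pencil_at_def sum_three A weier_def defs power2_eq_square power3_eq_cube algebra_simps)
  then have eq0: "(aT * d - b * e - c * al) * t^3 + (aT + aL * d - d * 0 - c * be) * t^2 * l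
      + (aL - d - c * ga) * t * l^2 + (- 1 - c * k) * l^3
      + (aN * d - b * g - bN * e) * t^2 * m + aN * t * l * m + 0 * l^2 * m + (- bN * g - c * n) * t * m^2
      + 0 * l * m^2 + 0 * m^3 = 0" for t l m
    by (simp only: c) simp
  note coeffs = ternary_cubic_coeffs_0[OF inf eq0]
  have aN: "aN = 0" and aL: "aL = d + c * ga" and aT: "aT = c * be - aL * d" and bg: "bN * g = - c * n"
    and be: "b * g = - bN * e"
    using coeffs(2,3,5,6,8) by algebra+
  have bN: "bN \<noteq> 0" using bg c nz by auto
  have c': "c = - 1 / k" using ck nz by (simp add: field_simps)
  have gg: "g = n / k / bN" using bg bN by (simp add: c' eq_divide_eq mult_ac split: if_splits)
  have ee: "e = - n * b / k / (bN * bN)"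
  proof -
    have "bN * e = - b * g" using be by simp
    then have "e = - b * g / bN" using bN by (simp add: field_simps)
    then show ?thesis by (simp add: gg mult_ac)
  qed
  \<comment> \<open>The remaining freedom is diagonal: scaling the third row by \<open>bN\<close>
    and the third column by its inverse keeps the last diagonal entry and turns
    \<open>b T + bN N\<close> into \<open>(b/bN) T + N\<close>.\<close>
  define P where "P = vec3 (vec3 1 0 0) (vec3 0 1 0) (vec3 0 0 bN)"
  define Q where "Q = vec3 (vec3 1 0 0) (vec3 0 1 0) (vec3 0 0 (1 / bN))"
  have d': "det P \<noteq> 0" "det Q \<noteq> 0" using bN by (simp_all add: P_def Q_def det_three)
  have "pencil_trans P Q A = weier_pencil n k be ga (b / bN) d"
    using bN by (simp add: vec_eq_three pencil_trans_def sum_three P_def Q_def A weier_pencil_def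
        defs[symmetric] aN gg ee aT aL c')
  with pencil_equivI[OF d'] show ?thesis by metis
qed

theorem normal_form:
  fixes A :: "'k::field^3^3^3"
  assumes inf: "infinite (UNIV :: 'k set)" and nz: "(2::'k) \<noteq> 0" "n \<noteq> 0" "k \<noteq> 0"
    and det: "det_rep_of (weier n k al be ga) A"
  shows "\<exists>b d. pencil_equiv A (weier_pencil n k be ga b d)"
proof -
  obtain A1 where 1: "pencil_equiv A A1" "\<forall>i. A1$i$0$2 = 0" "\<forall>i. A1$0$i$2 = 0"
    using normal_form_step1[OF det] by blast
  note det1 = det_rep_of_equiv[OF det 1(1)]
  obtain A2 where 2: "pencil_equiv A1 A2" "A2$0$0 = vec3 1 0 0" "A2$1$0 = vec3 0 1 0" "A2$2$0 = 0"
    "A2$0$1$2 = 0" "A2$0$2$2 = 0"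
    using normal_form_step2[OF det1 nz] 1 by blast
  note det2 = det_rep_of_equiv[OF det1 2(1)]
  obtain A3 where 3: "pencil_equiv A2 A3" "A3$0$0 = vec3 1 0 0" "A3$1$0 = vec3 0 1 0" "A3$2$0 = 0"
    "A3$0$1 = vec3 0 1 0" "A3$0$2 = 0"
    using normal_form_step3[OF det2 nz(3)] 2 by blast
  note det3 = det_rep_of_equiv[OF det2 3(1)]
  obtain A4 where 4: "pencil_equiv A3 A4" "A4$0$0 = vec3 1 0 0" "A4$1$0 = vec3 0 1 0" "A4$2$0 = 0"
    "A4$0$1 = vec3 0 1 0" "A4$0$2 = 0" "A4$2$2$1 = 1" "A4$2$2$2 = 0" "A4$1$2$1 = 0" "A4$2$1$1 = 0"
    using normal_form_step4[OF det3 nz(3)] 3 by blast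
  note det4 = det_rep_of_equiv[OF det3 4(1)]
  obtain b d where 5: "pencil_equiv A4 (weier_pencil n k be ga b d)"
    using normal_form_step5[OF inf det4 nz(2,3)] 4 by blast
  show ?thesis
    using 1(1) 2(1) 3(1) 4(1) 5 pencil_equiv_trans by blast
qed

section \<open>The invariant point of a representation\<close>

text \<open>If \<open>w\<close> kills the matrix at \<open>p\<close>, the three linear forms in
  \<open>w M(x)\<close> vanish at \<open>p\<close> and are therefore dependent; \<open>u\<close> is
  a relation between them. Read the other way, \<open>w\<close> is a relation between the three
  forms in \<open>M(x) u\<close>, so these have a common zero \<open>q\<close>.\<close>

definition linked :: "'k::field^3^3^3 \<Rightarrow> 'k^3 \<Rightarrow> 'k^3 \<Rightarrow> bool" where
  "linked A p q \<longleftrightarrow> (\<exists>w u. w \<noteq> 0 \<and> u \<noteq> 0 \<and> w v* pencil_at A p = 0 \<and>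
     (\<forall>x. (\<Sum>i\<in>UNIV. w$i * (pencil_at A x *v u)$i) = 0) \<and> pencil_at A q *v u = 0)"

lemma sum_vector_matrix:
  fixes w :: "'k::field^'n"
  shows "(\<Sum>i\<in>UNIV. (w v* P)$i * v$i) = (\<Sum>i\<in>UNIV. w$i * (P *v v)$i)"
  unfolding vector_matrix_mult_def matrix_vector_mult_def
  by (simp add: sum_distrib_left sum_distrib_right) (subst sum.swap, simp add: mult_ac)

text \<open>Writing \<open>A\<close> as \<open>P B Q\<close>, the witnesses for \<open>B\<close> are
  \<open>w P\<close> and \<open>Q u\<close>.\<close>

lemma linked_equiv:
  assumes "linked A p q" "pencil_equiv A B"
  shows "linked B p q"
proof -
  from assms(1) obtain w u where wu: "w \<noteq> 0" "u \<noteq> 0" "w v* pencil_at A p = 0"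
    "\<And>x. (\<Sum>i\<in>UNIV. w$i * (pencil_at A x *v u)$i) = 0" "pencil_at A q *v u = 0"
    unfolding linked_def by blast
  from pencil_equiv_sym[OF assms(2)] obtain P Q where PQ: "invertible P" "invertible Q" "A = pencil_trans P Q B"
    unfolding pencil_equiv_def by blast
  have at: "pencil_at A x = P ** pencil_at B x ** Q" for x by (simp add: PQ pencil_at_trans)
  obtain P' Q' where PQ': "P' ** P = mat 1" "P ** P' = mat 1" "Q ** Q' = mat 1" "Q' ** Q = mat 1"
    using PQ unfolding invertible_def by blast
  have Q0: "Q *v u \<noteq> 0"
  proof
    assume "Q *v u = 0"
    then have "Q' *v (Q *v u) = 0" by simp
    then show False using wu by (simp add: matrix_vector_mul_assoc PQ')
  qed
  have P0: "w v* P \<noteq> 0"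
  proof
    assume "w v* P = 0"
    then have "(w v* P) v* P' = 0" by simp
    then show False using wu by (simp add: vector_matrix_mul_assoc PQ')
  qed
  have "(w v* P) v* pencil_at B p = (w v* pencil_at A p) v* Q'"
    by (simp add: at vector_matrix_mul_assoc matrix_mul_assoc[symmetric] PQ')
  then have 1: "(w v* P) v* pencil_at B p = 0" using wu by simp
  have 2: "(\<Sum>i\<in>UNIV. (w v* P)$i * (pencil_at B x *v (Q *v u))$i) = 0" for x
    unfolding sum_vector_matrix using wu(4)[of x] by (simp add: at matrix_vector_mul_assoc matrix_mul_assoc)
  have "pencil_at B q *v (Q *v u) = P' *v (pencil_at A q *v u)"
    by (simp add: at matrix_vector_mul_assoc matrix_mul_assoc PQ')
  then have 3: "pencil_at B q *v (Q *v u) = 0" using wu by simp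
  from Q0 P0 1 2 3 show ?thesis unfolding linked_def by blast
qed

text \<open>At the flex the first row vanishes, so \<open>w\<close> is the first unit vector;
  \<open>w M(x)\<close> is \<open>(T, L, 0)\<close>, so \<open>u\<close> is the third. The third
  column vanishes at \<open>q\<close> exactly when \<open>L = -d T\<close> and
  \<open>N = -b T\<close>.\<close>

lemma linked_weier_pencil:
  assumes n: "n \<noteq> 0" "k \<noteq> 0" and linked: "linked (weier_pencil n k be ga b d) (vec3 0 0 1) q"
  shows "q$1 = - d * q$0 \<and> q$2 = - b * q$0"
proof -
  let ?A = "weier_pencil n k be ga b d"
  from linked obtain w u where wu: "w \<noteq> 0" "u \<noteq> 0" "w v* pencil_at ?A (vec3 0 0 1) = 0"
    "\<And>x. (\<Sum>i\<in>UNIV. w$i * (pencil_at ?A x *v u)$i) = 0" "pencil_at ?A q *v u = 0"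
    unfolding linked_def by blast
  note simps = vec_eq_three vector_matrix_mult_def matrix_vector_mult_def sum_three pencil_at_def weier_pencil_def
  have w: "w$1 = 0" "w$2 = 0" using wu(3) n by (simp_all add: simps)
  with wu(1) have w0: "w$0 \<noteq> 0" by (simp add: vec_eq_three)
  have u: "u$0 = 0" "u$1 = 0"
    using wu(4)[of "vec3 1 0 0"] wu(4)[of "vec3 0 1 0"] w w0 by (simp_all add: simps)
  with wu(2) have u2: "u$2 \<noteq> 0" by (simp add: vec_eq_three)
  have "(q$1 + d * q$0) * u$2 = 0" "(q$2 + b * q$0) * u$2 = 0"
    using wu(5) u by (simp_all add: simps algebra_simps)
  with u2 show ?thesis by (simp add: eq_neg_iff_add_eq_0)
qed

lemma weier_pencil_linked:
  "linked (weier_pencil n k be ga b d) (vec3 0 0 1) (vec3 1 (- d) (- b))"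
  unfolding linked_def
  by (rule exI[of _ "vec3 1 0 0"], rule exI[of _ "vec3 0 0 1"])
    (simp add: vec_eq_three vector_matrix_mult_def matrix_vector_mult_def sum_three pencil_at_def weier_pencil_def)

lemma linked_zero:
  assumes "det_rep_of F A" "linked A p q"
  shows "F q = 0"
proof -
  from assms(2) obtain u where "u \<noteq> 0" "pencil_at A q *v u = 0" unfolding linked_def by blast
  then have "det (pencil_at A q) = 0"
    using matrix_left_invertible_ker[of "pencil_at A q"] invertible_det_nz[of "pencil_at A q"]
    by (metis invertible_left_inverse)
  then show ?thesis using assms(1) unfolding det_rep_of_def by auto
qed

theorem weier_det_rep_linked:
  fixes A :: "'k::field^3^3^3"
  assumes inf: "infinite (UNIV :: 'k set)" and nz: "(2::'k) \<noteq> 0" "n \<noteq> 0" "k \<noteq> 0"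
    and det: "det_rep_of (weier n k al be ga) A"
  shows "\<exists>q. q$0 \<noteq> 0 \<and> weier n k al be ga q = 0 \<and> linked A (vec3 0 0 1) q"
proof -
  obtain b d where "pencil_equiv A (weier_pencil n k be ga b d)"
    using normal_form[OF assms] by blast
  then have "linked A (vec3 0 0 1) (vec3 1 (- d) (- b))"
    using linked_equiv[OF weier_pencil_linked] pencil_equiv_sym by blast
  with linked_zero[OF det this] show ?thesis by (intro exI[of _ "vec3 1 (- d) (- b)"]) simp
qed

theorem weier_det_rep_equiv:
  fixes A :: "'k::field^3^3^3"
  assumes inf: "infinite (UNIV :: 'k set)" and nz: "(2::'k) \<noteq> 0" "n \<noteq> 0" "k \<noteq> 0"
    and det: "det_rep_of (weier n k al be ga) A" "det_rep_of (weier n k al be ga) B"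
    and q: "q \<noteq> 0" "linked A (vec3 0 0 1) q" "linked B (vec3 0 0 1) q"
  shows "pencil_equiv A B"
proof -
  obtain b d where A: "pencil_equiv A (weier_pencil n k be ga b d)"
    using normal_form[OF inf nz det(1)] by blast
  obtain b' d' where B: "pencil_equiv B (weier_pencil n k be ga b' d')"
    using normal_form[OF inf nz det(2)] by blast
  have 1: "q$1 = - d * q$0 \<and> q$2 = - b * q$0" "q$1 = - d' * q$0 \<and> q$2 = - b' * q$0"
    using linked_weier_pencil[OF nz(2,3)] linked_equiv q A B by blast+
  then have "q$0 \<noteq> 0" using q by (auto simp: vec_eq_three)
  with 1 have "d = d'" "b = b'" by auto
  with A B show ?thesis using pencil_equiv_sym pencil_equiv_trans by blast
qed

theorem weier_linked_unique:
  fixes A :: "'k::field^3^3^3"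
  assumes inf: "infinite (UNIV :: 'k set)" and nz: "(2::'k) \<noteq> 0" "n \<noteq> 0" "k \<noteq> 0"
    and det: "det_rep_of (weier n k al be ga) A"
    and q: "q \<noteq> 0" "linked A (vec3 0 0 1) q" "q' \<noteq> 0" "linked A (vec3 0 0 1) q'"
  shows "\<exists>c. c \<noteq> 0 \<and> q' = c *s q"
proof -
  obtain b d where A: "pencil_equiv A (weier_pencil n k be ga b d)"
    using normal_form[OF inf nz det] by blast
  have 1: "q$1 = - d * q$0 \<and> q$2 = - b * q$0" "q'$1 = - d * q'$0 \<and> q'$2 = - b * q'$0"
    using linked_weier_pencil[OF nz(2,3)] linked_equiv q A by blast+
  then have "q$0 \<noteq> 0" "q'$0 \<noteq> 0" using q by (auto simp: vec_eq_three)
  with 1 show ?thesis by (intro exI[of _ "q'$0 / q$0"]) (simp add: vec_eq_three)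
qed

section \<open>Representations of the Hesse cubic\<close>

definition pencil_subst :: "'k::comm_ring_1^3^3 \<Rightarrow> 'k^3^3^3 \<Rightarrow> 'k^3^3^3" where
  "pencil_subst S A = (\<chi> i j. A$i$j v* S)"

lemma pencil_at_subst: "pencil_at (pencil_subst S A) y = pencil_at A (S *v y)"
  by (simp add: vec_eq_iff pencil_at_def pencil_subst_def vector_matrix_mult_def
      matrix_vector_mult_def sum_three algebra_simps)

text \<open>The inverse substitution is \<open>y0 = (-lam x0 + 3 x1 + 3 x2)/6\<close>,
  \<open>y1 = x0/6\<close>, \<open>y2 = (x1 - x2)/6\<close>. Exchanging \<open>x1\<close> and
  \<open>x2\<close> negates only \<open>y2\<close>, which is why the new equation is even in
  \<open>y2\<close>.\<close>

definition hesse_weier :: "'k::comm_ring_1 \<Rightarrow> 'k^3^3" where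
  "hesse_weier lam = vec3 (vec3 0 6 0) (vec3 1 lam 3) (vec3 1 lam (- 3))"

text \<open>The first coordinate is the tangent to the cubic at the flex \<open>(0, -1, 1)\<close>.\<close>

lemma hesse_weier:
  fixes lam :: "'k::field"
  shows "hesse lam (hesse_weier lam *v y) = 2 * weier 27 (4 * (27 + lam^3)) 1 (6 * lam) (9 * lam^2) y"
proof -
  have "hesse_weier lam *v y =
      vec3 (6 * y$1) (y$0 + lam * y$1 + 3 * y$2) (y$0 + lam * y$1 - 3 * y$2)"
    by (simp add: vec_eq_three hesse_weier_def matrix_vector_mult_def sum_three)
  moreover have "(6*l)^3 + (t + lam * l + 3 * n)^3 + (t + lam * l - 3 * n)^3
      + lam * (6*l) * (t + lam * l + 3 * n) * (t + lam * l - 3 * n)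
    = 2 * (27 * t * n^2 + 4 * (27 + lam^3) * l^3 + 1 * t^3 + 6 * lam * t^2 * l + 9 * lam^2 * t * l^2)"
    for t l n by algebra
  ultimately show ?thesis
    unfolding hesse_def weier_def by (simp only: vec3_nth)
qed

lemma pencil_at_scale: "pencil_at A (c *s x) = (\<chi> i. c *s (pencil_at A x $ i))"
  by (simp add: vec_eq_iff pencil_at_def sum_distrib_left mult_ac)

lemma linked_scale:
  assumes "linked A p q"
  shows "linked A p (c *s q)"
proof -
  have "pencil_at A (c *s q) *v u = c *s (pencil_at A q *v u)" for u
    by (simp add: vec_eq_iff pencil_at_scale matrix_vector_mult_def sum_distrib_left mult_ac)
  moreover from assms obtain w u where "w \<noteq> 0" "u \<noteq> 0" "w v* pencil_at A p = 0"
    "\<forall>x. (\<Sum>i\<in>UNIV. w$i * (pencil_at A x *v u)$i) = 0" "pencil_at A q *v u = 0"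
    unfolding linked_def by blast
  ultimately show ?thesis unfolding linked_def by (intro exI[of _ w] exI[of _ u]) simp
qed

locale hesse_cubic =
  fixes lam :: "'k::field"
  assumes inf: "infinite (UNIV :: 'k set)"
    and two: "(2::'k) \<noteq> 0" and three: "(3::'k) \<noteq> 0" and smooth: "lam^3 + 27 \<noteq> 0"
begin

abbreviation flex :: "'k^3" where "flex \<equiv> vec3 0 (- 1) 1"

abbreviation "W \<equiv> weier 27 (4 * (27 + lam^3)) 1 (6 * lam) (9 * lam^2)"

lemma char_nz: "(4::'k) \<noteq> 0" "(6::'k) \<noteq> 0" "(9::'k) \<noteq> 0" "(27::'k) \<noteq> 0" "(36::'k) \<noteq> 0"
  "4 * (27 + lam^3) \<noteq> 0"
proof -
  show 4: "(4::'k) \<noteq> 0" and 6: "(6::'k) \<noteq> 0" and 9: "(9::'k) \<noteq> 0"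
    using no_zero_divisors[OF two two] no_zero_divisors[OF two three] no_zero_divisors[OF three three]
    by simp_all
  then show "(27::'k) \<noteq> 0" "(36::'k) \<noteq> 0"
    using no_zero_divisors[OF 9 three] no_zero_divisors[OF 6 6] by simp_all
  show "4 * (27 + lam^3) \<noteq> 0"
    by (rule no_zero_divisors[OF 4]) (use smooth in \<open>simp add: add.commute\<close>)
qed

lemma hesse_weier_surj: "\<exists>y. x = hesse_weier lam *v y"
proof -
  let ?y = "vec3 ((- lam * x$0 + 3 * x$1 + 3 * x$2) / 6) (x$0 / 6) ((x$1 - x$2) / 6)"
  have "6 * (hesse_weier lam *v ?y)$i = 6 * x$i" for i
  proof -
    have "\<forall>i. 6 * (hesse_weier lam *v ?y)$i = 6 * x$i"
      unfolding forall_three using char_nz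
      by (simp add: hesse_weier_def matrix_vector_mult_def sum_three field_simps)
    then show ?thesis ..
  qed
  with char_nz have "x = hesse_weier lam *v ?y" by (simp add: vec_eq_iff)
  then show ?thesis ..
qed

lemma det_rep_of_subst:
  assumes "det_rep_of (hesse lam) A"
  shows "det_rep_of W (pencil_subst (hesse_weier lam) A)"
proof -
  from assms obtain c where "c \<noteq> 0" "\<And>y. det (pencil_at A y) = c * hesse lam y"
    unfolding det_rep_of_def by blast
  with two show ?thesis
    unfolding det_rep_of_def pencil_at_subst by (intro exI[of _ "c * 2"]) (simp add: hesse_weier)
qed

lemma hesse_weier_flex: "hesse_weier lam *v vec3 0 0 1 = (- 3) *s flex"
  by (simp add: vec_eq_three hesse_weier_def matrix_vector_mult_def sum_three)

lemma linked_subst: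
  "linked (pencil_subst (hesse_weier lam) A) (vec3 0 0 1) q \<longleftrightarrow> linked A flex (hesse_weier lam *v q)"
proof -
  have 1: "w v* pencil_at A ((- 3) *s flex) = 0 \<longleftrightarrow> w v* pencil_at A flex = 0" for w
  proof -
    have "w v* pencil_at A ((- 3) *s flex) = (- 3) *s (w v* pencil_at A flex)"
      unfolding pencil_at_scale by (simp add: vec_eq_iff vector_matrix_mult_def sum_three algebra_simps)
    with three show ?thesis by (simp only: vector_mul_eq_0) simp
  qed
  have 2: "(\<forall>x. (\<Sum>i\<in>UNIV. w$i * (pencil_at A (hesse_weier lam *v x) *v u)$i) = 0) \<longleftrightarrow>
      (\<forall>x. (\<Sum>i\<in>UNIV. w$i * (pencil_at A x *v u)$i) = 0)" for w u
    using hesse_weier_surj by metis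
  show ?thesis
    unfolding linked_def pencil_at_subst hesse_weier_flex 1 2 ..
qed

lemma pencil_equiv_subst:
  assumes "pencil_equiv (pencil_subst (hesse_weier lam) A) (pencil_subst (hesse_weier lam) B)"
  shows "pencil_equiv A B"
proof -
  let ?S = "hesse_weier lam"
  from assms obtain P Q where PQ: "invertible P" "invertible Q"
      "pencil_subst ?S B = pencil_trans P Q (pencil_subst ?S A)"
    unfolding pencil_equiv_def by blast
  have "B = pencil_trans P Q A"
  proof (rule pencil_eqI)
    fix x
    obtain y where "x = ?S *v y" using hesse_weier_surj by blast
    then show "pencil_at B x = pencil_at (pencil_trans P Q A) x"
      using PQ(3) by (metis pencil_at_subst pencil_at_trans)
  qed
  with PQ show ?thesis unfolding pencil_equiv_def by blast
qed

text \<open>The negated condition says that \<open>q\<close> is not a multiple of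
  \<open>flex\<close>. It comes from the nonvanishing first Weierstrass coordinate.\<close>

theorem det_rep_linked:
  assumes "det_rep_of (hesse lam) A"
  shows "\<exists>q. hesse lam q = 0 \<and> \<not> (q$0 = 0 \<and> q$1 + q$2 = 0) \<and> linked A flex q"
proof -
  obtain q where q: "q$0 \<noteq> 0" "W q = 0" "linked (pencil_subst (hesse_weier lam) A) (vec3 0 0 1) q"
    using weier_det_rep_linked[OF inf two char_nz(4,6) det_rep_of_subst[OF assms]] by blast
  let ?q = "hesse_weier lam *v q"
  have "hesse lam ?q = 0" "linked A flex ?q" using q by (simp_all add: hesse_weier linked_subst)
  moreover have "\<not> (?q$0 = 0 \<and> ?q$1 + ?q$2 = 0)"
  proof
    assume "?q$0 = 0 \<and> ?q$1 + ?q$2 = 0"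
    then have "6 * q$1 = 0" "2 * q$0 + 2 * (lam * q$1) = 0"
      by (simp_all add: hesse_weier_def matrix_vector_mult_def sum_three algebra_simps)
    then show False using two char_nz q by simp
  qed
  ultimately show ?thesis by blast
qed

theorem det_rep_equiv:
  assumes "det_rep_of (hesse lam) A" "det_rep_of (hesse lam) B"
    and "q \<noteq> 0" "linked A flex q" "linked B flex q"
  shows "pencil_equiv A B"
proof -
  obtain y where y: "q = hesse_weier lam *v y" using hesse_weier_surj by blast
  have "y \<noteq> 0" using assms(3) unfolding y by auto
  with assms y show ?thesis
    using weier_det_rep_equiv[OF inf two char_nz(4,6) det_rep_of_subst det_rep_of_subst]
    by (blast intro: pencil_equiv_subst linked_subst[THEN iffD2])
qed

theorem linked_unique:
  assumes "det_rep_of (hesse lam) A"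
    and "q \<noteq> 0" "linked A flex q" "q' \<noteq> 0" "linked A flex q'"
  shows "\<exists>c. c \<noteq> 0 \<and> q' = c *s q"
proof -
  obtain y where y: "q = hesse_weier lam *v y" using hesse_weier_surj by blast
  obtain y' where y': "q' = hesse_weier lam *v y'" using hesse_weier_surj by blast
  have "y \<noteq> 0" "y' \<noteq> 0" using assms unfolding y y' by auto
  moreover have "linked (pencil_subst (hesse_weier lam) A) (vec3 0 0 1) y"
      "linked (pencil_subst (hesse_weier lam) A) (vec3 0 0 1) y'"
    using assms y y' linked_subst by blast+
  ultimately obtain c where "c \<noteq> 0" "y' = c *s y"
    using weier_linked_unique[OF inf two char_nz(4,6) det_rep_of_subst[OF assms(1)]] by blast
  moreover from this have "q' = c *s q"
    unfolding y y' by (simp add: vec_eq_iff matrix_vector_mult_def sum_distrib_left mult_ac)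
  ultimately show ?thesis by blast
qed

end

section \<open>Moore matrices\<close>

definition moore :: "'k::comm_ring_1^3 \<Rightarrow> 'k^3^3^3" where
  "moore a = (\<chi> i j k. if k = i - j then a$(i + j) else 0)"

lemma moore_matrix_pencil: "moore_matrix a = pencil_poly (moore a)"
proof -
  have "Const3 (if P then c else 0) * x = (if P then Const3 c * x else 0)" for P and c :: 'a and x
    by simp
  then show ?thesis
    by (simp add: vec_eq_iff moore_matrix_def pencil_poly_def linform_def moore_def)
qed

lemma pencil_at_moore:
  "pencil_at (moore a) x =
     vec3 (vec3 (a$0 * x$0) (a$1 * x$2) (a$2 * x$1))
          (vec3 (a$1 * x$1) (a$2 * x$0) (a$0 * x$2))
          (vec3 (a$2 * x$2) (a$0 * x$1) (a$1 * x$0))"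
proof -
  have mod3: "- 1 = (2 :: 3)" "- 2 = (1 :: 3)" "3 = (0 :: 3)" "4 = (1 :: 3)"
    by simp_all
  show ?thesis
    by (simp add: vec_eq_three pencil_at_def moore_def sum_three mod3)
qed

text \<open>The determinant is \<open>a0 a1 a2 (x0^3 + x1^3 + x2^3) - (a0^3 + a1^3 + a2^3) x0 x1
  x2\<close>, and the equation of the curve at \<open>a\<close> rewrites the second bracket as
  \<open>- lam a0 a1 a2\<close>.\<close>

lemma linear_det_rep_moore:
  assumes "hesse lam a = 0" "a$0 * a$1 * a$2 \<noteq> (0::'k::field)"
  shows "linear_det_rep lam (moore_matrix a)"
proof -
  have "(a$0)^3 + (a$1)^3 + (a$2)^3 = - (lam * a$0 * a$1 * a$2)"
    using assms(1) by (simp add: hesse_def eq_neg_iff_add_eq_0)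
  from arg_cong[OF this, of Const3] have *: "Const3 (a$0)^3 + Const3 (a$1)^3 + Const3 (a$2)^3 =
      - (Const3 lam * Const3 (a$0) * Const3 (a$1) * Const3 (a$2))"
    by (simp add: Const3_add Const3_mult Const3_power Const3_uminus)
  have "det (moore_matrix a) = Const3 (a$0) * Const3 (a$1) * Const3 (a$2) * (Var3 0^3 + Var3 1^3 + Var3 2^3)
      - (Const3 (a$0)^3 + Const3 (a$1)^3 + Const3 (a$2)^3) * (Var3 0 * Var3 1 * Var3 2)"
    by (simp add: det_three moore_matrix_rows Let_def power3_eq_cube algebra_simps)
  also have "\<dots> = Const3 (a$0 * a$1 * a$2) * hesse_poly lam"
    unfolding * by (simp add: hesse_poly_def hesse_def Const3_mult algebra_simps)
  finally have "det (moore_matrix a) = Const3 (a$0 * a$1 * a$2) * hesse_poly lam" .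
  moreover have "homogeneous3 1 (moore_matrix a $ i $ j)" for i j
    by (simp add: moore_matrix_def Const3_mult_Var3 homogeneous3_single[simplified])
  ultimately show ?thesis using assms(2) unfolding linear_det_rep_def by blast
qed

definition swap3 :: "'k^3 \<Rightarrow> 'k^3" where
  "swap3 x = vec3 (x$0) (x$2) (x$1)"

text \<open>
  Below, \<open>swap3\<close> is negation on the curve, \<open>tangential a\<close> represents \<open>-2a\<close> and \<open>tripling a\<close> represents \<open>3a\<close>.
\<close>

definition tangential :: "'k::comm_ring_1^3 \<Rightarrow> 'k^3" where
  "tangential a = vec3 (a$0 * ((a$1)^3 - (a$2)^3)) (a$1 * ((a$2)^3 - (a$0)^3)) (a$2 * ((a$0)^3 - (a$1)^3))"

definition tripling :: "'k::comm_ring_1^3 \<Rightarrow> 'k^3" where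
  "tripling a = (let X = (a$0)^3; Y = (a$1)^3; Z = (a$2)^3; m = a$0 * a$1 * a$2 in
     vec3 (m * (X^2 + Y^2 + Z^2 - X*Y - Y*Z - Z*X))
          (X^2*Y + Y^2*Z + Z^2*X - 3*X*Y*Z) (X^2*Z + Y^2*X + Z^2*Y - 3*X*Y*Z))"

text \<open>The left side is the tangent form at the flex, evaluated at \<open>3a\<close>. That
  tangent meets the curve only at \<open>o\<close>, with multiplicity 3, so the pullback vanishes to
  order 3 at the nine 3-torsion points, which are cut out by \<open>a0 a1 a2 = 0\<close>. The proof
  is an identity in the cubes of the coordinates, after \<open>lam\<close> is eliminated.\<close>

lemma tripling_linear:
  assumes "hesse lam a = 0"
  shows "- lam * tripling a$0 + 3 * (tripling a$1 + tripling a$2) =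
    - (lam^3 + 27) * (a$0 * a$1 * a$2)^3"
proof -
  define X Y Z m where "X = (a$0)^3" "Y = (a$1)^3" "Z = (a$2)^3" "m = a$0 * a$1 * a$2"
  note defs = this
  have e1: "lam * m = - (X + Y + Z)" using assms by (simp add: hesse_def defs eq_neg_iff_add_eq_0 algebra_simps)
  have m: "m^3 = X * Y * Z" by (simp add: defs power_mult_distrib)
  show ?thesis
  proof -
    let ?E = "X^2 + Y^2 + Z^2 - X*Y - Y*Z - Z*X"
    have l: "- lam * (m * ?E) = - (lam * m) * ?E" by (simp add: mult.assoc)
    have r: "- (lam^3 + 27) * m^3 = - ((lam * m)^3) - 27 * m^3" by (simp add: algebra_simps power_mult_distrib)
    show ?thesis
      unfolding tripling_def Let_def defs[symmetric] vec3_nth l r unfolding e1 m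
      by (simp add: algebra_simps power2_eq_square power3_eq_cube)
  qed
qed

context hesse_cubic
begin

lemma linear_det_rep_pencil_poly:
  assumes "linear_det_rep lam (pencil_poly A)"
  shows "det_rep_of (hesse lam) A"
proof -
  from assms obtain c where c: "c \<noteq> 0" and det: "det (pencil_poly A) = Const3 c * hesse_poly lam"
    unfolding linear_det_rep_def by blast
  have "det (pencil_at A x) = c * hesse lam x" for x
    using arg_cong[OF det, of "eval_poly3 x"]
    by (simp add: eval_det eval_pencil_poly eval_hesse_poly)
  with c show ?thesis unfolding det_rep_of_def by blast
qed

lemma tripling_nonzero:
  assumes "hesse lam a = 0" "a$0 * a$1 * a$2 \<noteq> 0"
  shows "tripling a \<noteq> 0"
proof
  assume "tripling a = 0"
  with tripling_linear[OF assms(1)] have "- (lam^3 + 27) * (a$0 * a$1 * a$2)^3 = 0"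
    by (simp only: zero_index) simp
  with smooth assms(2) show False by (metis mult_eq_0_iff neg_equal_0_iff_equal power_not_zero)
qed

lemma tangential_nonzero:
  assumes "hesse lam a = 0" "a$0 * a$1 * a$2 \<noteq> 0"
  shows "tangential a \<noteq> 0"
proof
  assume "tangential a = 0"
  then have "tangential a $ 0 = 0" "tangential a $ 1 = 0" by simp_all
  then have eq: "(a$1)^3 = (a$2)^3" "(a$0)^3 = (a$2)^3" using assms(2) by (simp_all add: tangential_def)
  have "tripling a = 0"
    unfolding tripling_def Let_def eq by (simp add: vec_eq_three algebra_simps power2_eq_square)
  with tripling_nonzero[OF assms] show False by contradiction
qed

text \<open>At the flex the Moore matrix is skew-symmetric with kernel \<open>swap3 a\<close>. The
  forms in \<open>w M(x)\<close> are combinations of \<open>x0\<close> and \<open>x1 + x2\<close>;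
  the cross product of the two coefficient vectors gives their relation, which up to sign is
  \<open>swap3 (tangential a)\<close>.\<close>

lemma moore_linked:
  assumes "hesse lam a = 0" "a$0 * a$1 * a$2 \<noteq> 0"
  shows "linked (moore a) flex (tripling a)"
proof -
  let ?w = "swap3 a" and ?u = "swap3 (tangential a)"
  have "?w \<noteq> 0" using assms(2) by (auto simp: swap3_def vec_eq_three)
  moreover have "?u \<noteq> 0"
    using tangential_nonzero[OF assms] by (auto simp: swap3_def vec_eq_three)
  moreover have "?w v* pencil_at (moore a) flex = 0"
    by (simp add: vec_eq_three vector_matrix_mult_def sum_three pencil_at_moore swap3_def)
  moreover have "(\<Sum>i\<in>UNIV. ?w$i * (pencil_at (moore a) x *v ?u)$i) = 0" for x
    by (simp add: matrix_vector_mult_def sum_three pencil_at_moore swap3_def tangential_def power3_eq_cube algebra_simps)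
  moreover have "pencil_at (moore a) (tripling a) *v ?u = 0"
    by (simp add: vec_eq_three matrix_vector_mult_def sum_three pencil_at_moore swap3_def tangential_def
        tripling_def Let_def power2_eq_square power3_eq_cube algebra_simps)
  ultimately show ?thesis unfolding linked_def by blast
qed

end

section \<open>Cube roots and the image of tripling\<close>

lemma eq_cube_imp:
  fixes x y :: "'k::field"
  assumes "x^3 = y^3"
  shows "\<exists>z. z^3 = 1 \<and> x = z * y"
proof (cases "y = 0")
  case True
  then show ?thesis using assms by (intro exI[of _ 1]) simp
next
  case False
  then show ?thesis using assms by (intro exI[of _ "x / y"]) (simp add: power_divide)
qed

lemma cube_root_of_unity_exists: "\<exists>w :: 'k::alg_closed_field. w^2 + w + 1 = 0"
proof -
  have "\<exists>w :: 'k. poly [:1, 1, 1:] w = 0" by (rule alg_closed_imp_poly_has_root) simp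
  then show ?thesis by (simp add: algebra_simps power2_eq_square)
qed

lemma cubed_resolvent:
  fixes w :: "'k::idom"
  assumes "w^2 + w + 1 = 0"
  shows "(X + w*Y + w^2*Z)^3 = X^3 + Y^3 + Z^3 + 6*(X*Y*Z) + 3*w*(X^2*Y + Y^2*Z + Z^2*X) + 3*w^2*(X^2*Z + Y^2*X + Z^2*Y)"
proof -
  have "w^3 = 1" using assms by algebra
  then show ?thesis by algebra
qed

text \<open>
  In the cubes \<open>X, Y, Z\<close> of the coordinates of \<open>a\<close>, the three linear forms \<open>h, h1, h2\<close> in \<open>tripling a\<close> are
  \<open>-(lam^3 + 27) (a\<^sub>0 a\<^sub>1 a\<^sub>2)\<^sup>3\<close> and the cubes of the Lagrange resolvents \<open>X + w Y + w\<^sup>2 Z\<close>, \<open>X + w\<^sup>2 Y + w Z\<close>.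
  So \<open>a\<close> is found by extracting cube roots, inverting the discrete Fourier transform and extracting
  cube roots again.
\<close>

theorem tripling_surj:
  fixes lam :: "'k::alg_closed_field"
  assumes three: "(3::'k) \<noteq> 0" and smooth: "lam^3 + 27 \<noteq> 0"
    and q: "hesse lam q = 0" "\<not> (q$0 = 0 \<and> q$1 + q$2 = 0)"
  shows "\<exists>a. hesse lam a = 0 \<and> a$0 * a$1 * a$2 \<noteq> 0 \<and> tripling a = q"
proof -
  have cancel: "3 * x = 0 \<Longrightarrow> x = 0" "3 * x = 3 * y \<Longrightarrow> x = y" for x y :: 'k
    using three by (simp_all add: mult.commute)
  obtain w :: 'k where w: "w^2 + w + 1 = 0" using cube_root_of_unity_exists by blast
  define q0 q1 q2 where "q0 = q$0" "q1 = q$1" "q2 = q$2"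
  note q_defs = this
  have curve: "q0^3 + q1^3 + q2^3 + lam * q0 * q1 * q2 = 0" using q(1) by (simp add: hesse_def q_defs)
  define h h1 h2 where "h = - lam * q0 + 3 * q1 + 3 * q2"
    "h1 = - lam * q0 + 3 * w * q1 + 3 * w^2 * q2" "h2 = - lam * q0 + 3 * w^2 * q1 + 3 * w * q2"
  note h_defs = this
  \<comment> \<open>This is the factorisation of \<open>A^3 + B^3 + C^3 - 3 A B C\<close> over the
    cube roots of unity, with \<open>A = -lam q0\<close>, \<open>B = 3 q1\<close>,
    \<open>C = 3 q2\<close>; on the curve it collapses to a multiple of \<open>q0^3\<close>.\<close>
  have hhh: "- (h * h1 * h2) = (lam^3 + 27) * q0^3"
    using curve w unfolding h_defs by algebra
  obtain m' where m': "m'^3 = - h / (lam^3 + 27)" using nth_root_exists[of 3] by auto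
  obtain s1 where s1: "s1^3 = h1" using nth_root_exists[of 3] by auto
  obtain s2 where s2: "s2^3 = h2" using nth_root_exists[of 3] by auto
  have "(m' * s1 * s2)^3 = - (h * h1 * h2) / (lam^3 + 27)"
    by (simp add: power_mult_distrib m' s1 s2)
  also have "\<dots> = q0^3" unfolding hhh by (rule nonzero_mult_div_cancel_left[OF smooth])
  finally obtain z where z: "z^3 = 1" "q0 = z * (m' * s1 * s2)"
    using eq_cube_imp by metis
  define m where "m = z * m'"
  have "m^3 = - h / (lam^3 + 27)" by (simp add: m_def power_mult_distrib z m')
  then have m: "(lam^3 + 27) * m^3 = - h" using smooth by simp
  have q0: "q0 = m * s1 * s2" by (simp add: z(2) m_def mult.assoc)
  \<comment> \<open>Here the flex is excluded: \<open>m = 0\<close> would put \<open>q\<close> on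
    its tangent and on \<open>q0 = 0\<close>. As \<open>m\<close> becomes the product of the
    coordinates of \<open>a\<close>, it has to be nonzero.\<close>
  have m0: "m \<noteq> 0"
  proof
    assume "m = 0"
    with m q0 have "h = 0" "q0 = 0" by simp_all
    then have "3 * (q1 + q2) = 0" by (simp add: h_defs distrib_left)
    from cancel(1)[OF this] \<open>q0 = 0\<close> q(2) show False by (simp add: q_defs)
  qed
  \<comment> \<open>On the curve the cubes of the coordinates of \<open>a\<close> must add up to
    \<open>-lam m\<close>. The next line is the inverse Fourier transform of
    \<open>(S, s1, s2)\<close>.\<close>
  define S where "S = - lam * m"
  define X Y Z where "X = (S + s1 + s2) / 3" "Y = (S + w^2 * s1 + w * s2) / 3" "Z = (S + w * s1 + w^2 * s2) / 3"
  then have XYZ: "3 * X = S + s1 + s2" "3 * Y = S + w^2 * s1 + w * s2" "3 * Z = S + w * s1 + w^2 * s2"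
    using three by (simp_all add: mult.commute)
  have "3 * (X + Y + Z) = 3 * X + 3 * Y + 3 * Z" by algebra
  also have "\<dots> = 3 * S" unfolding XYZ using w by algebra
  finally have "3 * (X + Y + Z) = 3 * S" .
  then have e1: "X + Y + Z = S" by (rule cancel)
  have "3 * (X + w * Y + w^2 * Z) = 3 * X + w * (3 * Y) + w^2 * (3 * Z)" by algebra
  also have "\<dots> = 3 * s1" unfolding XYZ using w by algebra
  finally have "3 * (X + w * Y + w^2 * Z) = 3 * s1" .
  then have r1: "X + w * Y + w^2 * Z = s1" by (rule cancel)
  have "3 * (X + w^2 * Y + w * Z) = 3 * X + w^2 * (3 * Y) + w * (3 * Z)" by algebra
  also have "\<dots> = 3 * s2" unfolding XYZ using w by algebra
  finally have "3 * (X + w^2 * Y + w * Z) = 3 * s2" .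
  then have r2: "X + w^2 * Y + w * Z = s2" by (rule cancel)
  have ss: "s1 * s2 = X^2 + Y^2 + Z^2 - X*Y - Y*Z - Z*X"
    using w unfolding r1[symmetric] r2[symmetric] by algebra
  have "27 * (X * Y * Z) = (3 * X) * (3 * Y) * (3 * Z)" by simp
  also have "\<dots> = S^3 + s1^3 + s2^3 - 3 * S * (s1 * s2)" unfolding XYZ using w by algebra
  also have "\<dots> = - (lam^3 * m^3) + h1 + h2 + 3 * lam * q0"
    unfolding q0 s1 s2 S_def by (simp add: power_mult_distrib)
  also have "\<dots> = 27 * m^3" using m w unfolding h_defs by algebra
  finally have "27 * (X * Y * Z) = 27 * m^3" .
  moreover have "(27::'k) \<noteq> 0"
    using no_zero_divisors[OF no_zero_divisors[OF three three] three] by simp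
  ultimately have e3: "X * Y * Z = m^3" by simp
  obtain a0' where a0': "a0'^3 = X" using nth_root_exists[of 3] by auto
  obtain a1 where a1: "a1^3 = Y" using nth_root_exists[of 3] by auto
  obtain a2 where a2: "a2^3 = Z" using nth_root_exists[of 3] by auto
  have "m^3 = (a0' * a1 * a2)^3" by (simp add: power_mult_distrib a0' a1 a2 e3)
  then obtain y where y: "y^3 = 1" "m = y * (a0' * a1 * a2)" using eq_cube_imp by metis
  \<comment> \<open>The three cube roots are chosen independently; the root of unity
    \<open>y\<close> corrects their product to exactly \<open>m\<close>.\<close>
  define a where "a = vec3 (y * a0') a1 a2"
  have a: "(a$0)^3 = X" "(a$1)^3 = Y" "(a$2)^3 = Z" "a$0 * a$1 * a$2 = m"
    by (simp_all add: a_def power_mult_distrib y a0' a1 a2 mult.assoc)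
  have "hesse lam a = X + Y + Z + lam * m"
    unfolding hesse_def a by (simp add: a(4)[symmetric] mult.assoc)
  then have curve_a: "hesse lam a = 0" by (simp add: e1 S_def)
  define P R where "P = X^2*Y + Y^2*Z + Z^2*X - 3*X*Y*Z" "R = X^2*Z + Y^2*X + Z^2*Y - 3*X*Y*Z"
  note PR = this
  have trip: "tripling a = vec3 q0 P R"
    by (simp only: tripling_def Let_def a PR q0 ss mult.assoc[of m])
  have c1: "h1 = S * (s1 * s2) + 3 * w * P + 3 * w^2 * R"
    unfolding s1[symmetric] ss unfolding e1[symmetric] r1[symmetric] cubed_resolvent[OF w] PR using w by algebra
  have "- (lam * q0) = S * (s1 * s2)" by (simp add: q0 S_def mult.assoc)
  with c1 have c1: "w * (P - q1) + w^2 * (R - q2) = 0" (is "?l = 0")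
  proof -
    have "3 * ?l = 0" using c1 \<open>- (lam * q0) = S * (s1 * s2)\<close> unfolding h_defs by algebra
    then show ?thesis by (rule cancel)
  qed
  have "- lam * q0 + 3 * (P + R) = - (lam^3 + 27) * m^3"
    using tripling_linear[OF curve_a] by (simp add: trip a)
  then have "3 * ((P - q1) + (R - q2)) = 0" using m unfolding h_defs by algebra
  then have c2: "(P - q1) + (R - q2) = 0" by (rule cancel)
  have "R - q2 = - (P - q1)" using c2 by (simp only: eq_neg_iff_add_eq_0 add.commute)
  with c1 have "w * (P - q1) - w^2 * (P - q1) = 0" by (simp add: algebra_simps)
  \<comment> \<open>The relations obtained from \<open>h1\<close> and from \<open>h\<close> are
    independent because \<open>(w - w^2)^2 = -3\<close> is nonzero.\<close>
  moreover have "3 * u = (w^2 - w) * (w * u - w^2 * u)" for u using w by algebra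
  ultimately have "3 * (P - q1) = 0" by (simp only: mult_zero_right)
  then have "P = q1" using cancel(1)[of "P - q1"] by simp
  with c2 have "R = q2" by simp
  have "tripling a = q" by (simp add: trip \<open>P = q1\<close> \<open>R = q2\<close> vec_eq_three q_defs)
  with curve_a a(4) m0 show ?thesis by metis
qed

section \<open>Chords and tangents\<close>

definition cross :: "'k::comm_ring_1^3 \<Rightarrow> 'k^3 \<Rightarrow> 'k^3" where
  "cross x y = vec3 (x$1 * y$2 - x$2 * y$1) (x$2 * y$0 - x$0 * y$2) (x$0 * y$1 - x$1 * y$0)"

definition dot :: "'k::comm_ring_1^3 \<Rightarrow> 'k^3 \<Rightarrow> 'k" where
  "dot x y = (\<Sum>i\<in>UNIV. x$i * y$i)"

lemmas vec3_simps = vec_eq_three cross_def dot_def sum_three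

lemma cross_eq_0_imp:
  fixes x y :: "'k::field^3"
  assumes "cross x y = 0" "y \<noteq> 0"
  shows "\<exists>c. x = c *s y"
proof -
  have eq: "x$1 * y$2 = x$2 * y$1" "x$2 * y$0 = x$0 * y$2" "x$0 * y$1 = x$1 * y$0"
    using assms(1) by (simp_all add: vec3_simps)
  consider "y$0 \<noteq> 0" | "y$1 \<noteq> 0" | "y$2 \<noteq> 0" using assms(2) by (auto simp: vec_eq_three)
  then show ?thesis
  proof cases
    case 1
    with eq show ?thesis by (intro exI[of _ "x$0 / y$0"]) (simp add: vec_eq_three eq_divide_eq)
  next
    case 2
    with eq show ?thesis by (intro exI[of _ "x$1 / y$1"]) (simp add: vec_eq_three eq_divide_eq)
  next
    case 3
    with eq show ?thesis by (intro exI[of _ "x$2 / y$2"]) (simp add: vec_eq_three eq_divide_eq)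
  qed
qed

lemma cross_cross: "cross a (cross b c) = dot a c *s b - dot a b *s c"
  by (simp add: vec3_simps algebra_simps)

lemma dot_nonzero_imp: "x \<noteq> 0 \<Longrightarrow> \<exists>u. dot x u \<noteq> (0::'k::field)"
proof -
  assume "x \<noteq> 0"
  then obtain i where "x$i \<noteq> 0" by (auto simp: vec_eq_iff)
  then have "dot x (axis i 1) \<noteq> 0"
    by (simp add: dot_def axis_def if_distrib[where f="\<lambda>y. _ * y"] cong: if_cong)
  then show ?thesis by blast
qed

lemma orthogonal_cross:
  fixes l x y :: "'k::field^3"
  assumes "dot l x = 0" "dot l y = 0" "cross x y \<noteq> 0"
  shows "\<exists>c. l = c *s cross x y"
  using cross_eq_0_imp[of l "cross x y"] assms by (simp add: cross_cross)

text \<open>Cramer's relation between the four vectors \<open>p, r, x, w\<close>: the coefficient of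
  \<open>w\<close> vanishes because \<open>x\<close> is on the line, and \<open>w\<close> is chosen
  off the line to make the coefficient of \<open>x\<close> nonzero.\<close>

lemma line_coordinates:
  fixes p r x :: "'k::field^3"
  assumes "cross p r \<noteq> 0" "dot (cross p r) x = 0"
  shows "\<exists>s t. x = s *s p + t *s r"
proof -
  obtain w where w: "dot (cross p r) w \<noteq> 0" using dot_nonzero_imp[OF assms(1)] by blast
  have "dot (cross p r) w *s x = dot (cross x r) w *s p + dot (cross p x) w *s r + dot (cross p r) x *s w"
    by (simp add: vec3_simps algebra_simps)
  also have "\<dots> = dot (cross x r) w *s p + dot (cross p x) w *s r" using assms(2) by simp
  finally have *: "dot (cross p r) w *s x = dot (cross x r) w *s p + dot (cross p x) w *s r" .
  have "x = (1 / dot (cross p r) w) *s (dot (cross p r) w *s x)" using w by simp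
  also have "\<dots> = (dot (cross x r) w / dot (cross p r) w) *s p + (dot (cross p x) w / dot (cross p r) w) *s r"
    unfolding * by (simp add: vec_eq_iff add_divide_distrib)
  finally show ?thesis by blast
qed

lemma proj_pt_eq_iff: "proj_pt x = proj_pt y \<longleftrightarrow> (\<exists>c. c \<noteq> 0 \<and> y = c *s x)"
proof
  assume "proj_pt x = proj_pt y"
  moreover have "y \<in> proj_pt y" unfolding proj_pt_def by (force intro: exI[of _ 1])
  ultimately show "\<exists>c. c \<noteq> 0 \<and> y = c *s x" unfolding proj_pt_def by auto
next
  assume "\<exists>c. c \<noteq> 0 \<and> y = c *s x"
  then obtain c where c: "c \<noteq> 0" "y = c *s x" by blast
  show "proj_pt x = proj_pt y"
  proof (intro subset_antisym subsetI)
    fix z assume "z \<in> proj_pt x"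
    then obtain d where "d \<noteq> 0" "z = d *s x" unfolding proj_pt_def by blast
    with c have "d / c \<noteq> 0" "z = (d / c) *s y" by simp_all
    then show "z \<in> proj_pt y" unfolding proj_pt_def by blast
  next
    fix z assume "z \<in> proj_pt y"
    then obtain d where "d \<noteq> 0" "z = d *s y" unfolding proj_pt_def by blast
    with c have "d * c \<noteq> 0" "z = (d * c) *s x" by simp_all
    then show "z \<in> proj_pt x" unfolding proj_pt_def by blast
  qed
qed

lemma proj_pt_eq_cross:
  assumes "x \<noteq> 0" "y \<noteq> 0"
  shows "proj_pt x = proj_pt y \<longleftrightarrow> cross x y = 0"
proof
  assume "proj_pt x = proj_pt y"
  then obtain c where "y = c *s x" unfolding proj_pt_eq_iff by blast
  then show "cross x y = 0" by (simp add: vec3_simps algebra_simps)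
next
  assume "cross x y = 0"
  then obtain c where c: "x = c *s y" using cross_eq_0_imp assms by blast
  with assms have "c \<noteq> 0" by auto
  with c show "proj_pt x = proj_pt y" unfolding proj_pt_eq_iff by (intro exI[of _ "1 / c"]) simp
qed

lemma proj_pt_scale: "c \<noteq> 0 \<Longrightarrow> proj_pt (c *s x) = proj_pt x"
  using proj_pt_eq_iff by metis

lemma dot_scale: "dot l (c *s x) = c * dot l x" "dot (c *s l) x = c * dot l x"
  by (simp_all add: dot_def sum_distrib_left mult_ac)

lemma proj_pt_in_line: "proj_pt x \<in> proj_line l \<longleftrightarrow> x \<noteq> 0 \<and> dot l x = 0"
proof
  assume "proj_pt x \<in> proj_line l"
  then obtain y where y: "proj_pt y = proj_pt x" "y \<noteq> 0" "dot l y = 0"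
    unfolding proj_line_def dot_def by auto
  from y(1) obtain c where "c \<noteq> 0" "x = c *s y" unfolding proj_pt_eq_iff by blast
  with y show "x \<noteq> 0 \<and> dot l x = 0" by (simp add: dot_scale)
qed (auto simp: proj_line_def dot_def)

lemma hesse_scale: "hesse lam (c *s x) = c^3 * hesse lam x"
  by (simp add: hesse_def power_mult_distrib power3_eq_cube algebra_simps)

lemma proj_pt_in_curve: "proj_pt x \<in> hesse_curve lam \<longleftrightarrow> x \<noteq> 0 \<and> hesse lam x = 0"
proof
  assume "proj_pt x \<in> hesse_curve lam"
  then obtain y where y: "proj_pt y = proj_pt x" "y \<noteq> 0" "hesse lam y = 0"
    unfolding hesse_curve_def by auto
  from y(1) obtain c where "c \<noteq> 0" "x = c *s y" unfolding proj_pt_eq_iff by blast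
  with y show "x \<noteq> 0 \<and> hesse lam x = 0" by (simp add: hesse_scale)
qed (auto simp: hesse_curve_def)

section \<open>Intersection of the cubic with a line\<close>

definition hesse_grad :: "'k::comm_ring_1 \<Rightarrow> 'k^3 \<Rightarrow> 'k^3" where
  "hesse_grad lam x = vec3 (3 * (x$0)^2 + lam * x$1 * x$2) (3 * (x$1)^2 + lam * x$0 * x$2)
     (3 * (x$2)^2 + lam * x$0 * x$1)"

lemma hesse_combination:
  "hesse lam (s *s p + t *s r) =
     s^3 * hesse lam p + s^2 * t * dot (hesse_grad lam p) r + s * t^2 * dot (hesse_grad lam r) p + t^3 * hesse lam r"
  by (simp add: hesse_def hesse_grad_def dot_def sum_three power2_eq_square power3_eq_cube algebra_simps)

lemma euler_hesse: "dot (hesse_grad lam x) x = 3 * hesse lam x"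
  by (simp add: hesse_def hesse_grad_def dot_def sum_three power2_eq_square power3_eq_cube algebra_simps)

text \<open>Points are viewed over \<open>K[t]\<close>, so that \<open>hesse_combination\<close>,
  valid over every commutative ring, also expands the cubic along a parametrised line.\<close>

definition const_vec :: "'k::zero^3 \<Rightarrow> 'k poly^3" where
  "const_vec p = (\<chi> i. [:p$i:])"

lemma const_hesse: "hesse [:lam:] (const_vec p) = [:hesse lam p:]"
  by (simp add: hesse_def const_vec_def power3_eq_cube mult_ac)

lemma const_hesse_grad:
  fixes p r :: "'k::comm_ring_1^3"
  shows "dot (hesse_grad [:lam:] (const_vec p)) (const_vec r) = [:dot (hesse_grad lam p) r:]"
proof -
  have 3: "smult c 3 = [:3 * c:]" for c :: 'k
    unfolding numeral_poly by simp
  show ?thesis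
    by (simp add: hesse_grad_def dot_def sum_three const_vec_def power2_eq_square 3 mult_ac)
qed

lemma line_poly:
  "hesse [:lam:] (\<chi> i. [:(s *s p + t *s r)$i, (s' *s p + t' *s r)$i:]) =
     [:s, s':]^3 * [:hesse lam p:] + [:s, s':]^2 * [:t, t':] * [:dot (hesse_grad lam p) r:]
      + [:s, s':] * [:t, t':]^2 * [:dot (hesse_grad lam r) p:] + [:t, t':]^3 * [:hesse lam r:]"
proof -
  have "(\<chi> i. [:(s *s p + t *s r)$i, (s' *s p + t' *s r)$i:]) = [:s, s':] *s const_vec p + [:t, t':] *s const_vec r"
    by (simp add: vec_eq_iff const_vec_def mult_ac)
  then show ?thesis
    by (simp only: hesse_combination const_hesse const_hesse_grad)
qed

lemma order_linear_0: "order 0 [:0, 1 :: 'k::field:] = 1"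
  using order_power_n_n[of "0::'k" 1] by simp

lemma order_0_linear:
  assumes "\<not> (a = 0 \<and> b = 0)"
  shows "order 0 [:a, b:] = (if a = (0::'k::field) then 1 else 0)"
proof (cases "a = 0")
  case True
  then have "order 0 [:a, b:] = order 0 (smult b [:0, 1:])" by simp
  also have "\<dots> = 1" using assms True by (subst order_smult) (auto simp: order_linear_0[simplified])
  finally show ?thesis using True by simp
next
  case False
  then show ?thesis by (simp add: order_0I)
qed

lemma cross_combination:
  "cross (s *s p + t *s r) (s' *s p + t' *s r) = (s * t' - t * s') *s cross p r"
  by (simp add: vec3_simps algebra_simps)

text \<open>On the line through \<open>p\<close> and \<open>r\<close> the cubic is a binary form,
  and its factor \<open>b i S - a i T\<close> vanishes exactly at \<open>a i p + b i r\<close>.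
  Along any parametrisation of the line each factor is a nonzero linear polynomial of order 1 or 0
  at \<open>t = 0\<close>, and orders add up. The factorisation is assumed over \<open>K[t]\<close>
  because linear polynomials are substituted for \<open>S\<close> and \<open>T\<close>.\<close>

lemma line_section_I:
  fixes p r :: "'k::field^3"
  assumes pr: "cross p r \<noteq> 0" and x: "\<And>i. i < 3 \<Longrightarrow> a i \<noteq> 0 \<or> b i \<noteq> 0" and k: "k \<noteq> 0"
    and factors: "\<And>S T. S^3 * [:hesse lam p:] + S^2 * T * [:dot (hesse_grad lam p) r:]
      + S * T^2 * [:dot (hesse_grad lam r) p:] + T^3 * [:hesse lam r:] =
      smult k ((smult (b 0) S - smult (a 0) T) * (smult (b 1) S - smult (a 1) T) * (smult (b 2) S - smult (a (2::nat)) T))"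
  shows "line_section lam (proj_pt (a 0 *s p + b 0 *s r)) (proj_pt (a 1 *s p + b 1 *s r)) (proj_pt (a 2 *s p + b 2 *s r))"
proof -
  let ?l = "cross p r"
  define z where "z i = a i *s p + b i *s r" for i
  have l: "dot ?l (s *s p + t *s r) = 0" for s t by (simp add: vec3_simps algebra_simps)
  have crossp: "cross (s *s p + t *s r) p = (- t) *s ?l" "cross (s *s p + t *s r) r = s *s ?l" for s t
    using cross_combination[of s p t r 1 0] cross_combination[of s p t r 0 1] by simp_all
  have comb0: "s *s p + t *s r \<noteq> 0" if "s \<noteq> 0 \<or> t \<noteq> 0" for s t
  proof
    assume "s *s p + t *s r = 0"
    with crossp[of s t] have "(- t) *s ?l = 0" "s *s ?l = 0" by (simp_all add: cross_def vec_eq_three)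
    with pr that show False by (simp only: vector_mul_eq_0) simp
  qed
  have z0: "z i \<noteq> 0" if "i < 3" for i unfolding z_def using x[OF that] by (intro comb0) auto
  have mult: "line_mult lam x v = count {#proj_pt (z 0), proj_pt (z 1), proj_pt (z 2)#} (proj_pt x)"
    if on: "proj_pt x \<in> proj_line ?l" "proj_pt v \<in> proj_line ?l" and ne: "proj_pt x \<noteq> proj_pt v" for x v
  proof -
    from on have x0: "x \<noteq> 0" "v \<noteq> 0" and "dot ?l x = 0" "dot ?l v = 0" by (simp_all add: proj_pt_in_line)
    then obtain s t s' t' where st: "x = s *s p + t *s r" "v = s' *s p + t' *s r"
      using line_coordinates[OF pr] by metis
    have "cross x v \<noteq> 0" using ne proj_pt_eq_cross x0 by blast
    then have det: "s * t' - t * s' \<noteq> 0" unfolding st cross_combination by auto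
    define L where "L i = smult (b i) [:s, s':] - smult (a i) [:t, t':]" for i
    have L: "L i = [:b i * s - a i * t, b i * s' - a i * t':]" for i by (simp add: L_def)
    have nz: "\<not> (b i * s - a i * t = 0 \<and> b i * s' - a i * t' = 0)" if "i < 3" for i
    proof
      assume *: "b i * s - a i * t = 0 \<and> b i * s' - a i * t' = 0"
      have "a i * (s * t' - t * s') = (b i * s - a i * t) * s' - (b i * s' - a i * t') * s"
        "b i * (s * t' - t * s') = (b i * s - a i * t) * t' - (b i * s' - a i * t') * t"
        by (simp_all add: algebra_simps)
      with * det x[OF that] show False by simp
    qed
    have ord: "order 0 (L i) = (if proj_pt (z i) = proj_pt x then 1 else 0)" if "i < 3" for i
    proof -
      have "cross (z i) x = (a i * t - b i * s) *s ?l" unfolding z_def st cross_combination ..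
      then have "cross (z i) x = 0 \<longleftrightarrow> b i * s - a i * t = 0" using pr by auto
      then have "proj_pt (z i) = proj_pt x \<longleftrightarrow> b i * s - a i * t = 0"
        using proj_pt_eq_cross[OF z0[OF that] x0(1)] by simp
      then show ?thesis unfolding L by (simp only: order_0_linear[OF nz[OF that]])
    qed
    have L0: "L i \<noteq> 0" if "i < 3" for i using nz[OF that] unfolding L by simp
    have "line_mult lam x v = order 0 (smult k (L 0 * L 1 * L 2))"
      unfolding line_mult_def st line_poly factors L_def ..
    also have "\<dots> = order 0 (L 0) + order 0 (L 1) + order 0 (L 2)"
      using k L0 by (simp add: order_smult order_mult)
    finally show ?thesis by (simp add: ord)
  qed
  show ?thesis
    unfolding line_section_def z_def[symmetric]
    using pr z0 mult by (intro exI[of _ ?l]) (auto simp: proj_pt_in_line z_def l)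
qed

lemma line_section_swap:
  assumes "line_section lam P Q R"
  shows "line_section lam Q P R" "line_section lam P R Q"
proof -
  have 1: "{P, Q, R} = {Q, P, R}" "{P, Q, R} = {P, R, Q}"
    "{#P, Q, R#} = {#Q, P, R#}" "{#P, Q, R#} = {#P, R, Q#}" by (auto simp: add_mset_commute)
  show "line_section lam Q P R" using assms unfolding line_section_def 1(1) 1(3) .
  show "line_section lam P R Q" using assms unfolding line_section_def 1(2) 1(4) .
qed

text \<open>With both end points on the curve the binary form is \<open>S T (A S + B T)\<close>,
  whose third zero is \<open>(B, -A)\<close>.\<close>

lemma line_section_chord:
  fixes p r :: "'k::field^3"
  assumes pr: "cross p r \<noteq> 0" "hesse lam p = 0" "hesse lam r = 0"
    and AB: "dot (hesse_grad lam p) r \<noteq> 0 \<or> dot (hesse_grad lam r) p \<noteq> 0"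
  shows "line_section lam (proj_pt p) (proj_pt r)
    (proj_pt (dot (hesse_grad lam r) p *s p - dot (hesse_grad lam p) r *s r))"
proof -
  let ?A = "dot (hesse_grad lam p) r" and ?B = "dot (hesse_grad lam r) p"
  define a where "a i = (if i = 0 then 1 else if i = 1 then 0 else ?B)" for i :: nat
  define b where "b i = (if i = 0 then 0 else if i = 1 then 1 else - ?A)" for i :: nat
  have "line_section lam (proj_pt (a 0 *s p + b 0 *s r)) (proj_pt (a 1 *s p + b 1 *s r)) (proj_pt (a 2 *s p + b 2 *s r))"
  proof (rule line_section_I[OF pr(1), where k = 1])
    show "a i \<noteq> 0 \<or> b i \<noteq> 0" for i using AB by (auto simp: a_def b_def)
    show "S^3 * [:hesse lam p:] + S^2 * T * [:?A:] + S * T^2 * [:?B:] + T^3 * [:hesse lam r:] =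
      smult 1 ((smult (b 0) S - smult (a 0) T) * (smult (b 1) S - smult (a 1) T) * (smult (b 2) S - smult (a 2) T))" for S T
      by (simp add: a_def b_def pr power2_eq_square algebra_simps)
  qed simp
  then show ?thesis by (simp add: a_def b_def vec_eq_iff[symmetric])
qed

text \<open>Only the \<open>T^3\<close> term survives. Each of the three equal factors is
  \<open>-T\<close>, hence the sign of \<open>k\<close>.\<close>

lemma line_section_flex:
  fixes p r :: "'k::field^3"
  assumes pr: "cross p r \<noteq> 0" "hesse lam p = 0" "hesse lam r \<noteq> 0"
    and AB: "dot (hesse_grad lam p) r = 0" "dot (hesse_grad lam r) p = 0"
  shows "line_section lam (proj_pt p) (proj_pt p) (proj_pt p)"
  using line_section_I[OF pr(1), where k = "- hesse lam r" and a = "\<lambda>_. 1" and b = "\<lambda>_. 0"] pr AB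
  by (simp add: power3_eq_cube mult_ac)

lemma ex_other_point:
  fixes l x :: "'k::field^3"
  assumes "l \<noteq> 0" "x \<noteq> 0" "dot l x = 0"
  shows "\<exists>v. dot l v = 0 \<and> cross x v \<noteq> 0"
proof -
  obtain u where u: "dot x u \<noteq> 0" using dot_nonzero_imp[OF assms(2)] by blast
  have "dot x l = 0" using assms(3) by (simp add: dot_def mult.commute)
  then have "cross x (cross l u) = dot x u *s l" by (simp add: cross_cross)
  moreover have "dot l (cross l u) = 0" by (simp add: vec3_simps algebra_simps)
  ultimately show ?thesis using u assms(1) by (intro exI[of _ "cross l u"]) simp
qed

context hesse_cubic
begin

text \<open>Multiplying the three equations gives \<open>(lam^3 + 27) (x0 x1 x2)^2 = 0\<close>. So
  some coordinate vanishes, and then the equations make the other two vanish as well.\<close>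

lemma hesse_grad_nonzero:
  assumes "x \<noteq> 0"
  shows "hesse_grad lam x \<noteq> 0"
proof
  assume "hesse_grad lam x = 0"
  then have eq: "3 * (x$0)^2 = - (lam * x$1 * x$2)" "3 * (x$1)^2 = - (lam * x$0 * x$2)"
    "3 * (x$2)^2 = - (lam * x$0 * x$1)"
    by (simp_all add: hesse_grad_def vec_eq_three eq_neg_iff_add_eq_0)
  have "27 * (x$0 * x$1 * x$2)^2 = (3 * (x$0)^2) * (3 * (x$1)^2) * (3 * (x$2)^2)"
    by (simp add: power_mult_distrib)
  also have "\<dots> = - (lam^3) * (x$0 * x$1 * x$2)^2"
    unfolding eq by (simp add: power2_eq_square power3_eq_cube)
  finally have "(lam^3 + 27) * (x$0 * x$1 * x$2)^2 = 0" by (simp add: distrib_right)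
  with smooth have "x$0 * x$1 * x$2 = 0" by (metis mult_eq_0_iff power_not_zero)
  then have "x$0 = 0 \<or> x$1 = 0 \<or> x$2 = 0" by simp
  with eq three have "x$0 = 0 \<and> x$1 = 0 \<and> x$2 = 0" by auto
  with assms show False by (simp add: vec_eq_three)
qed

text \<open>Multiplicity at least 2 makes the constant and the linear coefficient along the line
  vanish. Hence \<open>l\<close> and the gradient are both orthogonal to \<open>x\<close> and
  \<open>v\<close>, and so proportional.\<close>

lemma tangent_line_unique:
  assumes "l \<noteq> 0" "x \<noteq> 0" "dot l x = 0"
    and mult: "\<And>v. dot l v = 0 \<Longrightarrow> cross x v \<noteq> 0 \<Longrightarrow> line_mult lam x v \<ge> 2"
  shows "\<exists>c. c \<noteq> 0 \<and> l = c *s hesse_grad lam x"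
proof -
  obtain v where v: "dot l v = 0" "cross x v \<noteq> 0" using ex_other_point[OF assms(1-3)] by blast
  let ?p = "hesse [:lam:] (\<chi> i. [:x$i, v$i:])"
  have "?p = hesse [:lam:] (\<chi> i. [:(1 *s x + 0 *s v)$i, (0 *s x + 1 *s v)$i:])" by simp
  also have "\<dots> = [:1, 0:]^3 * [:hesse lam x:] + [:1, 0:]^2 * [:0, 1:] * [:dot (hesse_grad lam x) v:]
      + [:1, 0:] * [:0, 1:]^2 * [:dot (hesse_grad lam v) x:] + [:0, 1:]^3 * [:hesse lam v:]"
    by (rule line_poly)
  finally have p: "?p = [:hesse lam x, dot (hesse_grad lam x) v, dot (hesse_grad lam v) x, hesse lam v:]"
    by (simp add: power2_eq_square power3_eq_cube)
  have "[:- 0, 1:] ^ 2 dvd ?p"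
    using order_1[of 0 ?p] mult[OF v] unfolding line_mult_def by (meson le_imp_power_dvd dvd_trans)
  then obtain q where "?p = [:- 0, 1:]^2 * q" by (auto simp: dvd_def)
  then have "?p = pCons 0 (pCons 0 q)" by (simp add: power2_eq_square)
  then have "hesse lam x = 0" "dot (hesse_grad lam x) v = 0" unfolding p by simp_all
  with euler_hesse[of lam x] have "dot (hesse_grad lam x) x = 0" "dot (hesse_grad lam x) v = 0" by simp_all
  then obtain c where c: "hesse_grad lam x = c *s cross x v" using orthogonal_cross v by blast
  obtain d where d: "l = d *s cross x v" using orthogonal_cross v assms(3) by blast
  have "c \<noteq> 0" using c hesse_grad_nonzero[OF assms(2)] by auto
  moreover have "d \<noteq> 0" using d assms(1) by auto
  ultimately show ?thesis using c d by (intro exI[of _ "d / c"]) simp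
qed

text \<open>The line is determined by \<open>P\<close> and \<open>Q\<close>: by the two points if
  they differ, as the tangent if they coincide. The multiplicity at \<open>R\<close> then has the
  same value in both multisets, and cancelling \<open>P\<close> and \<open>Q\<close> leaves
  \<open>R = R'\<close>.\<close>

lemma line_section_unique:
  assumes "line_section lam P Q R" "line_section lam P Q R'"
  shows "R = R'"
proof -
  from assms(1)[unfolded line_section_def] obtain l where l: "l \<noteq> 0" "{P, Q, R} \<subseteq> proj_line l" and
    "\<forall>x v. proj_pt x \<in> proj_line l \<and> proj_pt v \<in> proj_line l \<and> proj_pt x \<noteq> proj_pt v \<longrightarrow>
      line_mult lam x v = count {#P, Q, R#} (proj_pt x)"
    by (elim exE conjE) (rule that)
  then have lm: "line_mult lam x v = count {#P, Q, R#} (proj_pt x)"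
    if "proj_pt x \<in> proj_line l" "proj_pt v \<in> proj_line l" "proj_pt x \<noteq> proj_pt v" for x v
    using that by blast
  from assms(2)[unfolded line_section_def] obtain l' where l': "l' \<noteq> 0" "{P, Q, R'} \<subseteq> proj_line l'" and
    "\<forall>x v. proj_pt x \<in> proj_line l' \<and> proj_pt v \<in> proj_line l' \<and> proj_pt x \<noteq> proj_pt v \<longrightarrow>
      line_mult lam x v = count {#P, Q, R'#} (proj_pt x)"
    by (elim exE conjE) (rule that)
  then have lm': "line_mult lam x v = count {#P, Q, R'#} (proj_pt x)"
    if "proj_pt x \<in> proj_line l'" "proj_pt v \<in> proj_line l'" "proj_pt x \<noteq> proj_pt v" for x v
    using that by blast
  obtain x where x: "P = proj_pt x" "x \<noteq> 0" "dot l x = 0"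
    using l(2) by (force simp: proj_line_def dot_def)
  obtain y where y: "Q = proj_pt y" "y \<noteq> 0" "dot l y = 0"
    using l(2) by (force simp: proj_line_def dot_def)
  obtain z where z: "R = proj_pt z" "z \<noteq> 0" "dot l z = 0"
    using l(2) by (force simp: proj_line_def dot_def)
  have x': "dot l' x = 0" and y': "dot l' y = 0"
    using l'(2) proj_pt_in_line unfolding x y by blast+
  have "\<exists>c. c \<noteq> 0 \<and> l' = c *s l"
  proof (cases "P = Q")
    case False
    then have "cross x y \<noteq> 0" using proj_pt_eq_cross x y by metis
    then obtain c d where cd: "l = c *s cross x y" "l' = d *s cross x y"
      using orthogonal_cross x(3) y(3) x' y' by metis
    then have "c \<noteq> 0" "d \<noteq> 0" using l(1) l'(1) by auto
    with cd show ?thesis by (intro exI[of _ "d / c"]) simp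
  next
    case True
    have ne: "v \<noteq> 0 \<and> proj_pt x \<noteq> proj_pt v" if "cross x v \<noteq> 0" for v
    proof -
      have "v \<noteq> 0" using that by (auto simp: cross_def vec_eq_three)
      with that show ?thesis using proj_pt_eq_cross x(2) by blast
    qed
    have "line_mult lam x v \<ge> 2" if v: "dot l v = 0" "cross x v \<noteq> 0" for v
    proof -
      have "line_mult lam x v = count {#P, Q, R#} (proj_pt x)"
        using ne[OF v(2)] v x by (intro lm) (auto simp: proj_pt_in_line)
      then show ?thesis using True x(1) by simp
    qed
    then obtain c where c: "c \<noteq> 0" "l = c *s hesse_grad lam x"
      using tangent_line_unique[OF l(1) x(2,3)] by blast
    have "line_mult lam x v \<ge> 2" if v: "dot l' v = 0" "cross x v \<noteq> 0" for v
    proof -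
      have "line_mult lam x v = count {#P, Q, R'#} (proj_pt x)"
        using ne[OF v(2)] v x x' by (intro lm') (auto simp: proj_pt_in_line)
      then show ?thesis using True x(1) by simp
    qed
    then obtain d where d: "d \<noteq> 0" "l' = d *s hesse_grad lam x"
      using tangent_line_unique[OF l'(1) x(2) x'] by blast
    from c d show ?thesis by (intro exI[of _ "d / c"]) simp
  qed
  then obtain c where c: "c \<noteq> 0" "l' = c *s l" by blast
  obtain v where v: "dot l v = 0" "cross z v \<noteq> 0" using ex_other_point[OF l(1) z(2,3)] by blast
  have v0: "v \<noteq> 0" using v by (auto simp: cross_def vec_eq_three)
  have ne: "proj_pt z \<noteq> proj_pt v" using proj_pt_eq_cross[OF z(2) v0] v by simp
  have "count {#P, Q, R#} R = line_mult lam z v"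
    unfolding z(1) using ne v z v0 by (intro lm[symmetric, unfolded z(1)]) (auto simp: proj_pt_in_line)
  also have "\<dots> = count {#P, Q, R'#} R"
    unfolding z(1) using ne v z v0 c by (intro lm') (auto simp: proj_pt_in_line dot_scale)
  finally show "R = R'" by (auto split: if_splits)
qed

lemma third_point_eq:
  assumes "line_section lam P Q R"
  shows "third_point lam P Q = R"
  unfolding third_point_def
proof (rule the_equality)
  show "line_section lam P Q R" by fact
  show "R' = R" if "line_section lam P Q R'" for R'
    using line_section_unique[OF that assms] .
qed

end

section \<open>Negation, doubling and tripling by chords and tangents\<close>

context hesse_cubic
begin

lemma hesse_grad_flex: "hesse_grad lam flex = vec3 (- lam) 3 3"
  by (simp add: hesse_grad_def vec_eq_three)

text \<open>The identity is the Weierstrass equation rewritten in the original coordinates without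
  denominators: where the tangent form vanishes, only a multiple of \<open>x0^3\<close> is
  left.\<close>

lemma flex_tangent:
  assumes "dot (hesse_grad lam flex) x = 0" "hesse lam x = 0"
  shows "x = x$2 *s flex"
proof -
  have id: "108 * (u^3 + v^3 + z^3 + lam * u * v * z) = (- lam * u + 3 * v + 3 * z) *
      (27 * (v - z)^2 + (- lam * u + 3 * v + 3 * z)^2 + 6 * lam * (- lam * u + 3 * v + 3 * z) * u + 9 * lam^2 * u^2)
      + 4 * (27 + lam^3) * u^3" for u v z by algebra
  have T: "- lam * x$0 + 3 * x$1 + 3 * x$2 = 0"
    using assms(1) unfolding hesse_grad_flex by (simp add: dot_def sum_three)
  have f: "(x$0)^3 + (x$1)^3 + (x$2)^3 + lam * x$0 * x$1 * x$2 = 0" using assms(2) unfolding hesse_def .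
  have "4 * (27 + lam^3) * (x$0)^3 = 0"
    using id[of "x$0" "x$1" "x$2"] unfolding T f by (simp only: mult_zero_left mult_zero_right add_0)
  then have x0: "x$0 = 0" using char_nz(6) by (metis mult_eq_0_iff power_not_zero)
  then have "3 * (x$1 + x$2) = 0" using T by (simp add: distrib_left)
  then have "x$1 + x$2 = 0" using three no_zero_divisors by metis
  with x0 show ?thesis by (simp add: vec_eq_three eq_neg_iff_add_eq_0)
qed

text \<open>A line inside the cubic would meet the tangent at the flex in a point \<open>z\<close>
  of the cubic. Either \<open>z\<close> is the zero vector and the line is the tangent, or
  \<open>z\<close> represents the flex and the line is tangent there; both times \<open>p\<close>
  and \<open>r\<close> would be multiples of \<open>flex\<close>.\<close>

lemma contains_no_line:
  assumes pr: "cross p r \<noteq> 0" "hesse lam p = 0" "hesse lam r = 0"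
  shows "dot (hesse_grad lam p) r \<noteq> 0 \<or> dot (hesse_grad lam r) p \<noteq> 0"
proof (rule ccontr)
  assume "\<not> ?thesis"
  then have on: "hesse lam (s *s p + t *s r) = 0" for s t
    using pr by (simp add: hesse_combination)
  let ?T = "dot (hesse_grad lam flex)"
  define z where "z = ?T r *s p + (- ?T p) *s r"
  have "?T z = 0" by (simp add: z_def dot_def sum_three algebra_simps)
  moreover have "hesse lam z = 0" unfolding z_def by (rule on)
  ultimately have z: "z = z$2 *s flex" by (rule flex_tangent)
  have cross: "cross z p = ?T p *s cross p r" "cross z r = ?T r *s cross p r"
    unfolding z_def using cross_combination[of "?T r" p "- ?T p" r 1 0] cross_combination[of "?T r" p "- ?T p" r 0 1]
    by simp_all
  \<comment> \<open>Both \<open>z + y\<close> and \<open>z - y\<close> lie on the cubic; comparing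
    the two expansions isolates the derivative at \<open>z\<close> in the direction
    \<open>y\<close>.\<close>
  have T0: "?T y = 0" if y: "y = s *s p + t *s r" and z2: "z$2 \<noteq> 0" for y s t
  proof -
    have "1 *s z + 1 *s y = (?T r + s) *s p + (- ?T p + t) *s r"
      "1 *s z + (- 1) *s y = (?T r - s) *s p + (- ?T p - t) *s r"
      by (simp_all add: vec_eq_iff z_def y algebra_simps)
    then have "hesse lam (1 *s z + 1 *s y) = 0" "hesse lam (1 *s z + (- 1) *s y) = 0"
      by (simp_all only: on)
    moreover have "hesse lam z = 0" "hesse lam y = 0" unfolding z_def y by (rule on)+
    ultimately have "dot (hesse_grad lam z) y + dot (hesse_grad lam y) z = 0"
        "- dot (hesse_grad lam z) y + dot (hesse_grad lam y) z = 0"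
      unfolding hesse_combination by simp_all
    then have "2 * dot (hesse_grad lam z) y = 0" by algebra
    then have "dot (hesse_grad lam z) y = 0" using two by simp
    moreover have "hesse_grad lam z = (z$2)^2 *s hesse_grad lam flex"
      by (subst z) (simp add: hesse_grad_def vec_eq_three power2_eq_square)
    ultimately show ?thesis using z2 by (simp add: dot_scale)
  qed
  have "?T p = 0 \<and> ?T r = 0"
  proof (cases "z$2 = 0")
    case True
    then have "z = 0" using z by simp
    then have "?T p *s cross p r = 0" "?T r *s cross p r = 0"
      using cross by (simp_all add: cross_def vec_eq_three)
    with pr(1) show ?thesis by simp
  next
    case False
    show ?thesis using T0[of p 1 0] T0[of r 0 1] False by simp
  qed
  then have "p = p$2 *s flex" "r = r$2 *s flex" using flex_tangent pr by blast+
  then have "cross p r = cross (p$2 *s flex) (r$2 *s flex)" by metis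
  also have "\<dots> = 0" by (simp add: vec3_simps)
  finally show False using pr(1) by simp
qed

lemma hesse_swap: "hesse lam (swap3 x) = hesse lam x"
  by (simp add: hesse_def swap3_def algebra_simps)

lemma swap_nonzero: "x \<noteq> 0 \<Longrightarrow> swap3 x \<noteq> (0 :: 'k^3)"
  by (auto simp: swap3_def vec_eq_three)

text \<open>The vector \<open>r - swap3 r\<close> is a multiple of \<open>flex\<close>, so
  \<open>r\<close>, \<open>swap3 r\<close> and the flex are collinear. Two cases degenerate:
  \<open>r\<close> is the flex itself, or \<open>r\<close> is fixed by the swap and its tangent
  passes through the flex.\<close>

lemma third_point_flex:
  assumes r: "r \<noteq> 0" "hesse lam r = 0"
  shows "third_point lam curve_zero (proj_pt r) = proj_pt (swap3 r)"
proof -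
  have flex: "flex \<noteq> 0" "hesse lam flex = 0" by (simp_all add: vec_eq_three hesse_def)
  consider (flex) "cross r flex = 0" | (sym) "cross r flex \<noteq> 0" "r$1 = r$2" | (gen) "cross r flex \<noteq> 0" "r$1 \<noteq> r$2"
    by blast
  then show ?thesis
  proof cases
    case flex
    then have eq: "proj_pt r = curve_zero" unfolding curve_zero_def
      using proj_pt_eq_cross r(1) \<open>flex \<noteq> 0\<close> by blast
    from flex \<open>flex \<noteq> 0\<close> obtain c where c: "r = c *s flex" using cross_eq_0_imp by blast
    have c0: "c \<noteq> 0" using c r by auto
    have "swap3 r = (- c) *s flex" by (simp add: c swap3_def vec_eq_three)
    then have eq': "proj_pt (swap3 r) = curve_zero"
      unfolding curve_zero_def using c0 by (simp only: proj_pt_scale neg_equal_0_iff_equal not_False_eq_True)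
    \<comment> \<open>A second point of the tangent at the flex, off the cubic: the second column of
      \<open>hesse_weier lam\<close>.\<close>
    let ?y = "vec3 6 lam lam"
    have "cross flex ?y \<noteq> 0" using char_nz by (simp add: cross_def vec_eq_three)
    moreover have "hesse lam ?y = 2 * (4 * (27 + lam^3))"
      by (simp add: hesse_def power3_eq_cube algebra_simps)
    then have "hesse lam ?y \<noteq> 0" using no_zero_divisors[OF two char_nz(6)] by (simp only: not_False_eq_True)
    moreover have "dot (hesse_grad lam flex) ?y = 0" "dot (hesse_grad lam ?y) flex = 0"
      by (simp_all add: hesse_grad_def dot_def sum_three)
    ultimately have "line_section lam curve_zero curve_zero curve_zero"
      unfolding curve_zero_def using line_section_flex \<open>hesse lam flex = 0\<close> by blast
    then show ?thesis unfolding eq eq' by (rule third_point_eq)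
  next
    case sym
    have A: "dot (hesse_grad lam r) flex = 0"
      using sym(2) by (simp add: hesse_grad_def dot_def sum_three)
    then have B: "dot (hesse_grad lam flex) r \<noteq> 0"
      using contains_no_line[OF sym(1) r(2) flex(2)] by simp
    have "line_section lam (proj_pt r) (proj_pt flex) (proj_pt (dot (hesse_grad lam flex) r *s r - 0 *s flex))"
      using line_section_chord[OF sym(1) r(2) flex(2)] A B by metis
    then have "line_section lam (proj_pt r) (proj_pt flex) (proj_pt r)" using B by (simp add: proj_pt_scale)
    moreover have "swap3 r = r" using sym(2) by (simp add: swap3_def vec_eq_three)
    ultimately show ?thesis
      unfolding curve_zero_def by (metis line_section_swap(1) third_point_eq)
  next
    case gen
    have cr: "cross r (swap3 r) \<noteq> 0"
    proof
      assume "cross r (swap3 r) = 0"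
      then have *: "r$1 * r$1 = r$2 * r$2" "r$2 * r$0 = r$0 * r$1"
        by (simp_all add: cross_def swap3_def vec_eq_three)
      have "(r$1 + r$2) * (r$1 - r$2) = 0" "r$0 * (r$1 - r$2) = 0" using * by (auto simp: algebra_simps)
      with gen(2) have "r$0 = 0" "r$1 = - r$2" by (simp_all add: eq_neg_iff_add_eq_0)
      then have "cross r flex = 0" by (simp add: cross_def vec_eq_three)
      with gen(1) show False by simp
    qed
    let ?A = "dot (hesse_grad lam r) (swap3 r)"
    have A: "dot (hesse_grad lam (swap3 r)) r = ?A"
      by (simp add: hesse_grad_def dot_def sum_three swap3_def mult_ac add_ac)
    have f: "hesse lam (swap3 r) = 0" using r(2) by (simp add: hesse_swap)
    have A0: "?A \<noteq> 0" using contains_no_line[OF cr r(2) f] A by simp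
    have "?A *s r - ?A *s swap3 r = (- (?A * (r$1 - r$2))) *s flex"
      by (simp add: vec_eq_three swap3_def algebra_simps)
    then have "proj_pt (?A *s r - ?A *s swap3 r) = proj_pt flex"
      using proj_pt_scale[of "- (?A * (r$1 - r$2))" flex] A0 gen(2) by simp
    then have "line_section lam (proj_pt r) (proj_pt (swap3 r)) (proj_pt flex)"
      using line_section_chord[OF cr r(2) f] A A0 by metis
    then have "line_section lam (proj_pt flex) (proj_pt r) (proj_pt (swap3 r))"
      using line_section_swap by metis
    then show ?thesis unfolding curve_zero_def by (rule third_point_eq)
  qed
qed

text \<open>The product of the differences of the cubes factors out of the sum of cubes and of the
  mixed term alike.\<close>

lemma hesse_tangential:
  assumes "hesse lam a = 0"
  shows "hesse lam (tangential a) = 0"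
proof -
  have id: "X * (Y - Z)^3 + Y * (Z - X)^3 + Z * (X - Y)^3 = (X + Y + Z) * ((Y - Z) * (Z - X) * (X - Y))" for X Y Z :: 'k
    by algebra
  let ?X = "(a$0)^3" and ?Y = "(a$1)^3" and ?Z = "(a$2)^3"
  have "hesse lam (tangential a) = hesse lam a * ((?Y - ?Z) * (?Z - ?X) * (?X - ?Y))"
    unfolding hesse_def distrib_right[of _ "lam * _ * _ * _"] id[symmetric]
    by (simp add: tangential_def power_mult_distrib)
  with assms show ?thesis by simp
qed

text \<open>A point that equals its own tangential point is a flex, and \<open>a\<close> is none.
  Concretely, the three cubes would coincide and \<open>tangential a\<close> would vanish.\<close>

lemma tangential_not_multiple:
  assumes "hesse lam a = 0" "a$0 * a$1 * a$2 \<noteq> 0"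
  shows "cross a (tangential a) \<noteq> 0"
proof
  assume 0: "cross a (tangential a) = 0"
  define X Y Z where "X = (a$0)^3" "Y = (a$1)^3" "Z = (a$2)^3"
  note defs = this
  have "(cross a (tangential a))$0 = a$1 * a$2 * (2 * X - Y - Z)"
    "(cross a (tangential a))$1 = a$2 * a$0 * (2 * Y - Z - X)"
    by (simp_all add: cross_def tangential_def defs algebra_simps)
  with 0 assms(2) have eq: "2 * X - Y - Z = 0" "2 * Y - Z - X = 0" by simp_all
  have "3 * (X - Y) = (2 * X - Y - Z) - (2 * Y - Z - X)" by (simp add: algebra_simps)
  with eq have "3 * (X - Y) = 0" by simp
  then have XY: "X = Y" using three by (simp only: mult_eq_0_iff) simp
  with eq have "Y = Z" by (simp add: algebra_simps)
  with XY have "tangential a = 0" by (simp add: tangential_def defs vec_eq_three)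
  with tangential_nonzero[OF assms] show False by contradiction
qed

text \<open>The tangential vector lies on the tangent at \<open>a\<close>, so the chord from
  \<open>a\<close> to it meets the curve again in \<open>a\<close>; reordering the section gives the
  tangent construction.\<close>

lemma third_point_tangent:
  assumes a: "hesse lam a = 0" "a$0 * a$1 * a$2 \<noteq> 0"
  shows "third_point lam (proj_pt a) (proj_pt a) = proj_pt (tangential a)"
proof -
  let ?t = "tangential a"
  note cr = tangential_not_multiple[OF a] and t = hesse_tangential[OF a(1)]
  have A: "dot (hesse_grad lam a) ?t = 0"
    by (simp add: hesse_grad_def dot_def sum_three tangential_def power2_eq_square power3_eq_cube algebra_simps)
  then have B: "dot (hesse_grad lam ?t) a \<noteq> 0" using contains_no_line[OF cr a(1) t] by simp
  have "line_section lam (proj_pt a) (proj_pt ?t) (proj_pt (dot (hesse_grad lam ?t) a *s a - 0 *s ?t))"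
    using line_section_chord[OF cr a(1) t] A B by metis
  then have "line_section lam (proj_pt a) (proj_pt ?t) (proj_pt a)" using B by (simp add: proj_pt_scale)
  then show ?thesis using line_section_swap(2) third_point_eq by blast
qed

text \<open>Geometrically \<open>2a = a\<close> would make \<open>a\<close> the identity, whose
  first coordinate is 0.\<close>

lemma double_not_multiple:
  assumes "hesse lam a = 0" "a$0 * a$1 * a$2 \<noteq> 0"
  shows "cross (swap3 (tangential a)) a \<noteq> 0"
proof
  assume 0: "cross (swap3 (tangential a)) a = 0"
  define x y z where "x = a$0" "y = a$1" "z = a$2"
  note defs = this
  define A B C where "A = y^3 - z^3" "B = z^3 - x^3" "C = x^3 - y^3"
  note ABC = this
  have nz: "x \<noteq> 0" "y \<noteq> 0" "z \<noteq> 0" using assms(2) by (simp_all add: defs)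
  have "y * B * x = x * A * z" "x * A * y = z * C * x"
    using 0 unfolding cross_def swap3_def tangential_def ABC defs by (simp_all add: vec_eq_three mult_ac)
  then have "x * (y * B) = x * (A * z)" "x * (A * y) = x * (z * C)" by (simp_all add: mult_ac)
  then have eq: "y * B = A * z" "A * y = z * C" using nz by simp_all
  have "A + B + C = 0" by (simp add: ABC)
  then have "(y^2 + y * z + z^2) * A = 0" using eq by algebra
  moreover have "A = (y - z) * (y^2 + y * z + z^2)" by (simp add: ABC power2_eq_square power3_eq_cube algebra_simps)
  ultimately have A0: "A = 0" by auto
  with eq nz have "B = 0" "C = 0" by simp_all
  with A0 have "tangential a = 0" by (simp add: tangential_def vec_eq_three ABC defs)
  with tangential_nonzero[OF assms] show False by contradiction
qed

lemma third_point_double: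
  assumes a: "hesse lam a = 0" "a$0 * a$1 * a$2 \<noteq> 0"
  shows "third_point lam (proj_pt (swap3 (tangential a))) (proj_pt a) = proj_pt (swap3 (tripling a))"
proof -
  let ?D = "swap3 (tangential a)"
  define x y z where "x = a$0" "y = a$1" "z = a$2"
  note xyz = this
  define d0 d1 d2 where "d0 = x * (y^3 - z^3)" "d1 = z * (x^3 - y^3)" "d2 = y * (z^3 - x^3)"
  note d = this
  have D: "?D = vec3 d0 d1 d2" by (simp add: swap3_def tangential_def d xyz vec_eq_three)
  define A B where "A = dot (hesse_grad lam ?D) a" "B = dot (hesse_grad lam a) ?D"
  note AB = this
  let ?w = "B *s ?D - A *s a"
  note cr = double_not_multiple[OF a]
  have f: "hesse lam ?D = 0" using hesse_tangential[OF a(1)] by (simp add: hesse_swap)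
  have sec: "line_section lam (proj_pt ?D) (proj_pt a) (proj_pt ?w)"
    using line_section_chord[OF cr f a(1) contains_no_line[OF cr f a(1)]] unfolding AB .
  have w0: "?w \<noteq> 0"
  proof
    assume "?w = 0"
    moreover have "cross ?w a = B *s cross ?D a" "cross ?D ?w = (- A) *s cross ?D a"
      by (simp_all add: vec3_simps algebra_simps)
    ultimately have "B *s cross ?D a = 0" "(- A) *s cross ?D a = 0"
      by (simp_all add: cross_def vec_eq_three)
    with cr have "B = 0" "A = 0" by simp_all
    with contains_no_line[OF cr f a(1)] show False by (simp add: AB)
  qed
  have lam: "lam * x * y * z = - (x^3 + y^3 + z^3)"
  proof -
    have "x^3 + y^3 + z^3 + lam * x * y * z = 0" using a(1) by (simp add: hesse_def xyz)
    then show ?thesis by (simp only: eq_neg_iff_add_eq_0 add.commute)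
  qed
  have A: "A = (3 * d0^2 + lam * d1 * d2) * x + (3 * d1^2 + lam * d0 * d2) * y + (3 * d2^2 + lam * d0 * d1) * z"
    unfolding AB D by (simp add: hesse_grad_def dot_def sum_three xyz)
  have B: "B = (3 * x^2 + lam * y * z) * d0 + (3 * y^2 + lam * x * z) * d1 + (3 * z^2 + lam * x * y) * d2"
    unfolding AB D by (simp add: hesse_grad_def dot_def sum_three xyz)
  \<comment> \<open>Multiplying by \<open>y z\<close> makes \<open>lam\<close> occur only in the
    product \<open>lam x y z\<close>, which the equation of the curve eliminates.\<close>
  define PA where "PA = 3 * y * z * (d0^2 * x + d1^2 * y + d2^2 * z) + (lam * x * y * z) *
    (y * z * (x^3 - y^3) * (z^3 - x^3) + y^2 * (y^3 - z^3) * (z^3 - x^3) + z^2 * (y^3 - z^3) * (x^3 - y^3))"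
  define PB where "PB = 3 * y * z * (x^2 * d0 + y^2 * d1 + z^2 * d2) + (lam * x * y * z) *
    (y * z * (y^3 - z^3) + z^2 * (x^3 - y^3) + y^2 * (z^3 - x^3))"
  have PA: "y * z * A = PA" unfolding A PA_def d by algebra
  have PB: "y * z * B = PB" unfolding B PB_def d by algebra
  \<comment> \<open>The common factor of the three coordinates. On the curve it is
    \<open>-y z\<close> times the tangent form \<open>-lam x + 3 y + 3 z\<close> at the flex; its
    nonvanishing is inferred from that of the chord vector.\<close>
  define c where "c = - (x^3 + (y + z)^3)"
  define X Y Z where "X = x^3" "Y = y^3" "Z = z^3"
  note XYZ = this
  have G: "swap3 (tripling a) = vec3 (x * y * z * (X^2 + Y^2 + Z^2 - X*Y - Y*Z - Z*X))
      (X^2*Z + Y^2*X + Z^2*Y - 3*X*Y*Z) (X^2*Y + Y^2*Z + Z^2*X - 3*X*Y*Z)"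
    by (simp add: swap3_def tripling_def Let_def vec_eq_three XYZ xyz)
  have 0: "PB * d0 - PA * x = c * (x * y * z * (X^2 + Y^2 + Z^2 - X*Y - Y*Z - Z*X))"
    unfolding PA_def PB_def lam d c_def XYZ by algebra
  have 1: "PB * d1 - PA * y = c * (X^2*Z + Y^2*X + Z^2*Y - 3*X*Y*Z)"
    unfolding PA_def PB_def lam d c_def XYZ by algebra
  have 2: "PB * d2 - PA * z = c * (X^2*Y + Y^2*Z + Z^2*X - 3*X*Y*Z)"
    unfolding PA_def PB_def lam d c_def XYZ by algebra
  have eq: "(y * z) *s ?w = c *s swap3 (tripling a)"
    unfolding G D vec_eq_three
    using 0 1 2 by (simp add: PA[symmetric] PB[symmetric] xyz[symmetric] algebra_simps)
  have yz: "y * z \<noteq> 0" using a(2) by (simp add: xyz)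
  have "c \<noteq> 0"
  proof
    assume "c = 0"
    then have "(y * z) *s ?w = 0" using eq by simp
    with yz w0 vector_mul_eq_0[of "y * z" ?w] show False by metis
  qed
  then have "proj_pt ?w = proj_pt (swap3 (tripling a))" using eq yz by (metis proj_pt_scale)
  with sec show ?thesis using third_point_eq by metis
qed

theorem curve_triple_eq:
  assumes a: "hesse lam a = 0" "a$0 * a$1 * a$2 \<noteq> 0"
  shows "curve_triple lam (proj_pt a) = proj_pt (tripling a)"
proof -
  have "det_rep_of (hesse lam) (moore a)"
    using linear_det_rep_moore[OF a] unfolding moore_matrix_pencil by (rule linear_det_rep_pencil_poly)
  \<comment> \<open>The point \<open>3a\<close> lies on the curve because the Moore matrix is
    singular there; this replaces the expansion of a form of degree 27.\<close>
  then have G: "hesse lam (swap3 (tripling a)) = 0"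
    using linked_zero[OF _ moore_linked[OF a]] by (simp add: hesse_swap)
  have [simp]: "swap3 (swap3 v) = v" for v :: "'k^3" by (simp add: swap3_def vec_eq_three)
  show ?thesis
    unfolding curve_triple_def curve_add_def
    by (simp add: third_point_tangent[OF a] third_point_double[OF a] G
        third_point_flex tangential_nonzero[OF a] tripling_nonzero[OF a] hesse_tangential[OF a(1)] swap_nonzero)
qed

end

text \<open>Over a finite field, 1 plus the product of all \<open>x - a\<close> would be a
  nonconstant polynomial without a root.\<close>

lemma infinite_UNIV_alg_closed: "infinite (UNIV :: 'k::alg_closed_field set)"
proof
  assume fin: "finite (UNIV :: 'k set)"
  define p :: "'k poly" where "p = (\<Prod>a\<in>UNIV. [:- a, 1:])"
  have 0: "poly p x = 0" for x using fin by (auto simp: p_def poly_prod)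
  have "degree p = card (UNIV :: 'k set)" by (simp add: p_def degree_prod_eq_sum_degree)
  also have "\<dots> > 0" using fin by (simp add: card_gt_0_iff)
  finally have "degree (p + 1) > 0" by (simp add: degree_add_eq_left)
  then obtain x where "poly (p + 1) x = 0" using alg_closed_imp_poly_has_root by blast
  with 0[of x] show False by simp
qed

theorem theoremA:
  fixes lam :: "'k::alg_closed_field"
  assumes "CHAR('k) \<noteq> 2" and "CHAR('k) \<noteq> 3"
    and "lam ^ 3 + 27 \<noteq> 0"
  shows "(\<forall>M. linear_det_rep lam M \<longrightarrow>
            (\<exists>a. proj_pt a \<in> hesse_curve lam \<and> a$0 * a$1 * a$2 \<noteq> 0 \<and>
                 equivalent_rep M (moore_matrix a))) \<and>
         (\<forall>a a'. proj_pt a \<in> hesse_curve lam \<and> a$0 * a$1 * a$2 \<noteq> 0 \<and>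
                 proj_pt a' \<in> hesse_curve lam \<and> a'$0 * a'$1 * a'$2 \<noteq> 0 \<longrightarrow>
            ((linear_det_rep lam (moore_matrix a) \<and> linear_det_rep lam (moore_matrix a') \<and>
              equivalent_rep (moore_matrix a) (moore_matrix a')) \<longleftrightarrow>
             curve_triple lam (proj_pt a) = curve_triple lam (proj_pt a')))"
proof -
  \<comment> \<open>The characteristic is never 1, so if it divides a prime it equals that
    prime.\<close>
  have prime: "CHAR('k) = p" if "prime p" "CHAR('k) dvd p" for p
    using that CHAR_not_1'[where 'a = 'k] by (metis One_nat_def prime_nat_iff)
  have two: "(2::'k) \<noteq> 0"
    using prime[of 2] assms(1) of_nat_eq_0_iff_char_dvd[where 'a = 'k, of 2] by auto
  have three: "(3::'k) \<noteq> 0"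
    using prime[of 3] assms(2) of_nat_eq_0_iff_char_dvd[where 'a = 'k, of 3] by auto
  interpret hesse_cubic lam
    by unfold_locales (use two three assms(3) infinite_UNIV_alg_closed in auto)
  have moore: "det_rep_of (hesse lam) (moore a)" if "hesse lam a = 0" "a$0 * a$1 * a$2 \<noteq> 0" for a
    using linear_det_rep_moore[OF that] unfolding moore_matrix_pencil by (rule linear_det_rep_pencil_poly)
  show ?thesis
  proof (intro conjI allI impI)
    fix M assume M: "linear_det_rep lam M"
    then obtain A where A: "M = pencil_poly A" by (rule linear_det_rep_pencil)
    then have det: "det_rep_of (hesse lam) A" using M linear_det_rep_pencil_poly by simp
    then obtain q where q: "hesse lam q = 0" "\<not> (q$0 = 0 \<and> q$1 + q$2 = 0)" "linked A flex q"
      using det_rep_linked by blast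
    from q(1,2) obtain a where a: "hesse lam a = 0" "a$0 * a$1 * a$2 \<noteq> 0" "tripling a = q"
      using tripling_surj[OF three assms(3)] by blast
    have "q \<noteq> 0" using q(2) by auto
    then have "pencil_equiv A (moore a)"
      using det_rep_equiv[OF det moore[OF a(1,2)] _ q(3)] moore_linked[OF a(1,2)] a(3) by simp
    then have "equivalent_rep M (moore_matrix a)"
      unfolding A moore_matrix_pencil equivalent_rep_pencil_poly .
    moreover have "a \<noteq> 0" using a(2) by auto
    ultimately show "\<exists>a. proj_pt a \<in> hesse_curve lam \<and> a$0 * a$1 * a$2 \<noteq> 0 \<and> equivalent_rep M (moore_matrix a)"
      using a by (auto simp: proj_pt_in_curve)
  next
    fix a a' :: "'k^3"
    assume "proj_pt a \<in> hesse_curve lam \<and> a$0 * a$1 * a$2 \<noteq> 0 \<and>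
      proj_pt a' \<in> hesse_curve lam \<and> a'$0 * a'$1 * a'$2 \<noteq> 0"
    then have a: "hesse lam a = 0" "a$0 * a$1 * a$2 \<noteq> 0" and a': "hesse lam a' = 0" "a'$0 * a'$1 * a'$2 \<noteq> 0"
      by (simp_all add: proj_pt_in_curve)
    note triple = curve_triple_eq[OF a] curve_triple_eq[OF a']
    note nz = tripling_nonzero[OF a] tripling_nonzero[OF a']
    have "pencil_equiv (moore a) (moore a') \<longleftrightarrow> proj_pt (tripling a) = proj_pt (tripling a')"
    proof
      assume "pencil_equiv (moore a) (moore a')"
      then have "linked (moore a') flex (tripling a)" by (rule linked_equiv[OF moore_linked[OF a]])
      then show "proj_pt (tripling a) = proj_pt (tripling a')"
        using linked_unique[OF moore[OF a'] nz(1) _ nz(2) moore_linked[OF a']] by (simp add: proj_pt_eq_iff)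
    next
      assume "proj_pt (tripling a) = proj_pt (tripling a')"
      then obtain c where c: "c \<noteq> 0" "tripling a' = c *s tripling a" unfolding proj_pt_eq_iff by blast
      have "linked (moore a) flex (c *s tripling a)" by (rule linked_scale[OF moore_linked[OF a]])
      then show "pencil_equiv (moore a) (moore a')"
        using det_rep_equiv[OF moore[OF a] moore[OF a'] nz(2) _ moore_linked[OF a']] c by simp
    qed
    then show "(linear_det_rep lam (moore_matrix a) \<and> linear_det_rep lam (moore_matrix a') \<and>
              equivalent_rep (moore_matrix a) (moore_matrix a')) \<longleftrightarrow>
             curve_triple lam (proj_pt a) = curve_triple lam (proj_pt a')"
      using linear_det_rep_moore[OF a] linear_det_rep_moore[OF a']
      unfolding triple moore_matrix_pencil equivalent_rep_pencil_poly by blast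
  qed
qed

end
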